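(* Let $f_1,\dots,f_n:\mathbb{R}^d\to\mathbb{R}$ be convex and $G$-Lipschitz continuous ($|f_i(x)-f_i(y)|\le G\|x-y\|$ for all $x,y$), let $g:\mathbb{R}^d\to\mathbb{R}$ be $\mu$-strongly convex ($\mu>0$), let $F=\frac1n\sum_{i=1}^n f_i+g$ and let $x^\star$ be the minimizer of $F$. By applying the adaptive smoothing technique (described in the context) to ASVRG, with suitable parameters, one obtains from the starting point $\widetilde x^0$ an $\varepsilon$-suboptimal solution, i.e. a (random) point $\widehat x$ with $\mathbb{E}[F(\widehat x)]-F(x^\star)\le\varepsilon$, using at most the following oracle complexity: $$\mathcal{O}\left(n\log\frac{F(\widetilde x^0)-F(x^\star)}{\varepsilon}+\frac{\sqrt{n}\,G}{\sqrt{\mu\varepsilon}}\right).$$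
   Context: For $\delta>0$ the $\delta$-Moreau envelope of $f_i$ is $f_i^{\delta}(x)=\inf_{y\in\mathbb{R}^d}\{f_i(y)+\frac{\delta}{2}\|x-y\|^2\}$; it is convex and $\delta$-smooth (differentiable with $\delta$-Lipschitz gradient), and $f_i^\delta\le f_i\le f_i^\delta+\frac{G^2}{2\delta}$. Put $F^{\delta}=\frac1n\sum_i f_i^\delta+g$. $g$ is $\mu$-strongly convex if $g(y)\ge g(x)+\xi^T(y-x)+\frac{\mu}{2}\|x-y\|^2$ for all $x,y$, $\xi\in\partial g(x)$. Oracle complexity is the total number of evaluations of component gradients $\nabla f_i^{\delta}(\cdot)$. $\mathcal O$ hides only an absolute constant, and, as usual, $\varepsilon$ is small compared to the initial gap, e.g. $0<\varepsilon\le\frac12(F(\widetilde x^0)-F(x^\star))$. Adaptive smoothing (Allen-Zhu and Hazan): given $\delta_0>0$ and a number of rounds $T$, set $\widehat x_0=\widetilde x^0$; for $t=0,\dots,T-1$, apply the base algorithm, started at $\widehat x_t$, to the objective $F^{\delta_t}$, running it until the expected objective gap of $F^{\delta_t}$ is reduced to at most $1/4$ of its initial value; call the result $\widehat x_{t+1}$ and put $\delta_{t+1}=2\delta_t$. The output is $\widehat x_T$. The parameters $\delta_0,T$ may depend on $F(\widetilde x^0)-F(x^\star)$, $G$ and $\varepsilon$. Base algorithm: ASVRG for an objective $\phi+h$, where $\phi=\frac1n\sum_i\phi_i$ with $\phi_i$ convex and $L$-smooth and $h$ $\mu$-strongly convex, with Option II, uniform sampling and restarts, with step size $0<\eta<1/L$,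 momentum parameter $0<\omega\le1-\frac{L\eta}{1-L\eta}$, epoch length $m$, started at $z^0$: set $x_0^1=y_0^1=z^0$. For $s=1,2,\dots$: compute $\nabla\phi(z^{s-1})$; for $t=1,\dots,m$, draw $i_t$ uniformly from $\{1,\dots,n\}$, independently, and set $\widetilde\nabla_t=\nabla\phi_{i_t}(x^s_{t-1})-\nabla\phi_{i_t}(z^{s-1})+\nabla\phi(z^{s-1})$, $y_t^s=\arg\min_y\{\langle\widetilde\nabla_t,y-y^s_{t-1}\rangle+\frac{\omega}{2\eta}\|y-y^s_{t-1}\|^2+h(y)\}$, $x_t^s=z^{s-1}+\omega(y_t^s-z^{s-1})$; then $z^s=\frac1m\sum_{t=1}^m x_t^s$, $y_0^{s+1}=y_m^s$, $x_0^{s+1}=(1-\omega)z^s+\omega y_m^s$. After every $\mathcal S=2\left(\frac{1-\omega}{\omega}+\frac{\omega}{\eta m\mu}\right)$ epochs (rounded up) the procedure is restarted from the initial point $\frac1{\mathcal S}\sum_{s=1}^{\mathcal S}z^s$. Here $\phi_i=f_i^{\delta_t}$, $L=\delta_t$, $h=g$.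
   Formalization: In the degenerate case G = 0 (all f_i constant) the initial smoothing parameter δ_0 may also depend on n and μ, since no δ_0 depending only on the initial gap, G and ε can give the bound as μ tends to 0; for G > 0 δ_0 depends only on these. *)

theory Defs
  imports "HOL-Probability.Probability"
begin

definition subdifferential :: "('a::euclidean_space \<Rightarrow> real) \<Rightarrow> 'a \<Rightarrow> 'a set" where
  "subdifferential g x = {\<xi>. \<forall>y. g x + \<xi> \<bullet> (y - x) \<le> g y}"

text \<open>Convexity is demanded separately: where the subdifferential is empty, the quadratic lower
  bound says nothing.\<close>

definition strongly_convex :: "real \<Rightarrow> ('a::euclidean_space \<Rightarrow> real) \<Rightarrow> bool" where
  "strongly_convex \<mu> g \<longleftrightarrow> convex_on UNIV g \<and>
     (\<forall>x y. \<forall>\<xi>\<in>subdifferential g x. g y \<ge> g x + \<xi> \<bullet> (y - x) + \<mu> / 2 * (norm (x - y))\<^sup>2)"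

definition moreau_envelope :: "real \<Rightarrow> ('a::euclidean_space \<Rightarrow> real) \<Rightarrow> 'a \<Rightarrow> real" where
  "moreau_envelope \<delta> f x = (INF y. f y + \<delta> / 2 * (norm (x - y))\<^sup>2)"

definition gradient :: "('a::euclidean_space \<Rightarrow> real) \<Rightarrow> 'a \<Rightarrow> 'a" where
  "gradient f x = (THE D. GDERIV f x :> D)"

definition objective ::
  "nat \<Rightarrow> (nat \<Rightarrow> 'a::euclidean_space \<Rightarrow> real) \<Rightarrow> ('a \<Rightarrow> real) \<Rightarrow> 'a \<Rightarrow> real" where
  "objective n \<phi> h x = (1 / real n) * (\<Sum>i<n. \<phi> i x) + h x"

definition full_gradient :: "nat \<Rightarrow> (nat \<Rightarrow> 'a::euclidean_space \<Rightarrow> real) \<Rightarrow> 'a \<Rightarrow> 'a" where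
  "full_gradient n \<phi> x = (1 / real n) *\<^sub>R (\<Sum>i<n. gradient (\<phi> i) x)"

primrec iterate_pmf :: "nat \<Rightarrow> ('s \<Rightarrow> 's pmf) \<Rightarrow> 's \<Rightarrow> 's pmf" where
  "iterate_pmf 0 K s = return_pmf s"
| "iterate_pmf (Suc k) K s = K s \<bind> iterate_pmf k K"

definition asvrg_parameters :: "real \<Rightarrow> real \<Rightarrow> real \<Rightarrow> nat \<Rightarrow> bool" where
  "asvrg_parameters L \<eta> \<omega> m \<longleftrightarrow>
     0 < \<eta> \<and> \<eta> < 1 / L \<and> 0 < \<omega> \<and> \<omega> \<le> 1 - L * \<eta> / (1 - L * \<eta>) \<and> 1 \<le> m"

text \<open>In all states below the last component counts the evaluations of component gradients so
  far: two per inner step, and \<open>n\<close> for the full gradient at the snapshot \<open>z\<close>.  The inner state is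
  \<open>(x, y, X, c)\<close> with \<open>X\<close> the sum of the \<open>x\<close>-iterates of the current epoch.\<close>

definition asvrg_step ::
  "nat \<Rightarrow> (nat \<Rightarrow> 'a::euclidean_space \<Rightarrow> real) \<Rightarrow> ('a \<Rightarrow> real) \<Rightarrow> real \<Rightarrow> real \<Rightarrow> 'a \<Rightarrow>
   'a \<times> 'a \<times> 'a \<times> nat \<Rightarrow> ('a \<times> 'a \<times> 'a \<times> nat) pmf" where
  "asvrg_step n \<phi> h \<eta> \<omega> z = (\<lambda>(x, y, X, c). do {
     i \<leftarrow> pmf_of_set {..<n};
     let v = gradient (\<phi> i) x - gradient (\<phi> i) z + full_gradient n \<phi> z;
     let y' = (ARG_MIN (\<lambda>u. v \<bullet> (u - y) + \<omega> / (2 * \<eta>) * (norm (u - y))\<^sup>2 + h u) u. True);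
     let x' = z + \<omega> *\<^sub>R (y' - z);
     return_pmf (x', y', X + x', c + 2)
   })"

text \<open>State \<open>(z, x, y, Z, c)\<close>: the snapshot, the points \<open>x\<close> and \<open>y\<close> from which the next inner loop
  starts, and the sum \<open>Z\<close> of the snapshots produced since the last restart.\<close>

definition asvrg_epoch ::
  "nat \<Rightarrow> (nat \<Rightarrow> 'a::euclidean_space \<Rightarrow> real) \<Rightarrow> ('a \<Rightarrow> real) \<Rightarrow> real \<Rightarrow> real \<Rightarrow> nat \<Rightarrow>
   'a \<times> 'a \<times> 'a \<times> 'a \<times> nat \<Rightarrow> ('a \<times> 'a \<times> 'a \<times> 'a \<times> nat) pmf" where
  "asvrg_epoch n \<phi> h \<eta> \<omega> m = (\<lambda>(z, x, y, Z, c). do {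
     (x', y', X, c') \<leftarrow> iterate_pmf m (asvrg_step n \<phi> h \<eta> \<omega> z) (x, y, 0, c + n);
     let z' = (1 / real m) *\<^sub>R X;
     return_pmf (z', (1 - \<omega>) *\<^sub>R z' + \<omega> *\<^sub>R y', y', Z + z', c')
   })"

definition restart_length :: "real \<Rightarrow> real \<Rightarrow> nat \<Rightarrow> real \<Rightarrow> nat" where
  "restart_length \<eta> \<omega> m \<mu> = nat \<lceil>2 * ((1 - \<omega>) / \<omega> + \<omega> / (\<eta> * real m * \<mu>))\<rceil>"

definition asvrg_period ::
  "nat \<Rightarrow> (nat \<Rightarrow> 'a::euclidean_space \<Rightarrow> real) \<Rightarrow> ('a \<Rightarrow> real) \<Rightarrow> real \<Rightarrow> real \<Rightarrow> real \<Rightarrow> nat \<Rightarrow>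
   'a \<times> nat \<Rightarrow> ('a \<times> nat) pmf" where
  "asvrg_period n \<phi> h \<mu> \<eta> \<omega> m = (\<lambda>(z0, c). do {
     let S = restart_length \<eta> \<omega> m \<mu>;
     (z, x, y, Z, c') \<leftarrow> iterate_pmf S (asvrg_epoch n \<phi> h \<eta> \<omega> m) (z0, z0, z0, 0, c);
     return_pmf ((1 / real S) *\<^sub>R Z, c')
   })"

definition asvrg ::
  "nat \<Rightarrow> (nat \<Rightarrow> 'a::euclidean_space \<Rightarrow> real) \<Rightarrow> ('a \<Rightarrow> real) \<Rightarrow> real \<Rightarrow> real \<Rightarrow> real \<Rightarrow> nat \<Rightarrow>
   nat \<Rightarrow> ('a \<times> nat) pmf \<Rightarrow> ('a \<times> nat) pmf" where
  "asvrg n \<phi> h \<mu> \<eta> \<omega> m k p = p \<bind> iterate_pmf k (asvrg_period n \<phi> h \<mu> \<eta> \<omega> m)"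

definition expected_value :: "('a \<Rightarrow> real) \<Rightarrow> ('a \<times> nat) pmf \<Rightarrow> real" where
  "expected_value P p = measure_pmf.expectation p (\<lambda>(x, c). P x)"

definition expected_gap :: "('a \<Rightarrow> real) \<Rightarrow> ('a \<times> nat) pmf \<Rightarrow> real" where
  "expected_gap P p = expected_value P p - (INF x. P x)"

text \<open>\<open>adaptive_smoothing \<dots> t p\<close>: after \<open>t\<close> rounds the current point and the evaluation count have
  joint law \<open>p\<close>.  Round \<open>t\<close> uses the smoothing parameter \<open>\<delta>0 * 2 ^ t\<close>, and ends after the first number
  \<open>k\<close> of restart periods at which the expected gap is at most a quarter of its value at the start of
  the round; a round that never reaches this level yields no law at all.\<close>

inductive adaptive_smoothing ::
  "nat \<Rightarrow> (nat \<Rightarrow> 'a::euclidean_space \<Rightarrow> real) \<Rightarrow> ('a \<Rightarrow> real) \<Rightarrow> real \<Rightarrow> real \<Rightarrow>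
   (nat \<Rightarrow> real) \<Rightarrow> (nat \<Rightarrow> real) \<Rightarrow> (nat \<Rightarrow> nat) \<Rightarrow> 'a \<Rightarrow> nat \<Rightarrow> ('a \<times> nat) pmf \<Rightarrow> bool"
  for n f g \<mu> \<delta>0 \<eta> \<omega> m x0 where
  start: "adaptive_smoothing n f g \<mu> \<delta>0 \<eta> \<omega> m x0 0 (return_pmf (x0, 0))"
| round: "adaptive_smoothing n f g \<mu> \<delta>0 \<eta> \<omega> m x0 (Suc t) (run k)"
  if "adaptive_smoothing n f g \<mu> \<delta>0 \<eta> \<omega> m x0 t p"
    and "\<phi> = (\<lambda>i. moreau_envelope (\<delta>0 * 2 ^ t) (f i))"
    and "run = (\<lambda>j. asvrg n \<phi> g \<mu> (\<eta> t) (\<omega> t) (m t) j p)"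
    and "expected_gap (objective n \<phi> g) (run k) \<le> 1 / 4 * expected_gap (objective n \<phi> g) p"
    and "\<forall>j<k. \<not> expected_gap (objective n \<phi> g) (run j)
                  \<le> 1 / 4 * expected_gap (objective n \<phi> g) p"

end

theory Submission
  imports Defs
begin

text \<open>
  One inner step of ASVRG satisfies, for every point \<open>w\<close>,
  \<open>E F(x') + \<omega>\<^sup>2/(2\<eta>) E |w - y'|\<^sup>2 \<le> (1 - \<omega>) F(z) + \<omega> F(w) + \<omega>\<^sup>2/(2\<eta>) |w - y|\<^sup>2\<close>: the descent lemma and the
  three-point inequality of the proximal step leave a variance term, which co-coercivity of the
  component gradients bounds by \<open>L\<eta>/(1 - L\<eta>) \<le> 1 - \<omega>\<close> times a Bregman distance, and convexity absorbs it.
  Averaging over an epoch and over the epochs between two restarts, with strong convexity turning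
  \<open>|w - z|\<^sup>2\<close> into an objective gap, shows that each restart period halves the expected gap.  So a
  smoothing round takes at most two periods.

  With \<open>m = n\<close>, \<open>\<eta> = 1/(4L)\<close> and \<open>\<omega> = 1/(2q)\<close>, where \<open>q = max 1 (sqrt (L/(n\<mu>)))\<close>, a period has at most \<open>8q\<close>
  epochs of \<open>3n\<close> evaluations each.  The expected value of \<open>F\<close> after \<open>t\<close> rounds exceeds the infimum of
  the smoothed objective of round \<open>t\<close> by at most \<open>4\<Delta>/2^t\<close>, since the gap is quartered while the
  smoothing error \<open>G\<^sup>2/(2\<delta>)\<close>, initially at most \<open>\<Delta>\<close>, is only halved.  Hence about \<open>log\<^sub>2(4\<Delta>/\<epsilon>)\<close> rounds suffice,
  and the terms \<open>sqrt (n \<delta>/\<mu>)\<close> of the cost form a geometric series dominated by the last round, where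
  \<open>\<delta>\<close> is of order \<open>G\<^sup>2/\<epsilon>\<close>.
\<close>

subsection \<open>Convex functions and Moreau envelopes\<close>

text \<open>Beyond a large radius the growth bound pushes \<open>f\<close> above \<open>f 0\<close>,
  so a minimum over a compact ball is global.\<close>

lemma attains_inf_of_quadratic_growth:
  fixes f :: "'a::euclidean_space \<Rightarrow> real"
  assumes cont: "continuous_on UNIV f" and "0 < \<kappa>"
    and growth: "\<And>y. f y \<ge> c - M * norm y + \<kappa> * (norm y)\<^sup>2"
  shows "\<exists>p. \<forall>y. f p \<le> f y"
proof -
  \<comment> \<open>The quotient makes \<open>\<kappa> * norm y\<close> dominate both constants
    beyond \<open>R\<close>; the 1 allows the gap \<open>\<bar>f 0 - c\<bar>\<close> to be
    multiplied by \<open>norm y\<close>.\<close>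
  define R where "R = max 1 ((\<bar>M\<bar> + \<bar>f 0 - c\<bar>) / \<kappa>)"
  have far: "f 0 \<le> f y" if "R < norm y" for y
  proof -
    have 1: "1 < norm y" and 2: "\<bar>M\<bar> + \<bar>f 0 - c\<bar> \<le> \<kappa> * norm y"
      using that \<open>0 < \<kappa>\<close> unfolding R_def by (auto simp: field_simps)
    have "(\<bar>M\<bar> + \<bar>f 0 - c\<bar>) * norm y \<le> \<kappa> * (norm y)\<^sup>2"
      using mult_right_mono[OF 2, of "norm y"] by (simp add: power2_eq_square algebra_simps)
    moreover have "\<bar>f 0 - c\<bar> * 1 \<le> \<bar>f 0 - c\<bar> * norm y"
      by (rule mult_left_mono) (use 1 in auto)
    moreover have "M * norm y \<le> \<bar>M\<bar> * norm y"
      by (rule mult_right_mono) auto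
    ultimately show ?thesis
      using growth[of y] by (simp add: algebra_simps)
  qed
  have "0 \<in> cball (0::'a) R" by (auto simp: R_def)
  then have ne: "cball (0::'a) R \<noteq> {}" by blast
  obtain p where p: "p \<in> cball 0 R" "\<And>y. y \<in> cball 0 R \<Longrightarrow> f p \<le> f y"
    using continuous_attains_inf[OF compact_cball ne continuous_on_subset[OF cont]] by auto
  have "f p \<le> f y" for y
    using p(2)[of y] p(2)[OF \<open>0 \<in> cball 0 R\<close>] far[of y] by (cases "norm y \<le> R") auto
  then show ?thesis by blast
qed

text \<open>For \<open>y\<close> outside the unit ball, the point of norm 1 on the segment from 0 to
  \<open>y\<close> has at least the minimal value over the ball; convexity along the segment then
  bounds \<open>g y\<close> linearly.\<close>

lemma convex_on_linear_lower_bound: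
  fixes g :: "'a::euclidean_space \<Rightarrow> real"
  assumes conv: "convex_on UNIV g"
  obtains c M where "\<And>y. g y \<ge> c - M * norm y"
proof -
  have "continuous_on (cball 0 1) g"
    using convex_on_continuous[OF open_UNIV conv] continuous_on_subset by blast
  then obtain p where p: "\<And>y. y \<in> cball 0 1 \<Longrightarrow> g p \<le> g y"
    using continuous_attains_inf[OF compact_cball, of 0 1 g] by fastforce
  have "g p \<le> g 0" using p[of 0] by simp
  have "g y \<ge> g p - (g 0 - g p) * norm y" for y
  proof (cases "norm y \<le> 1")
    case True
    then have "g p \<le> g y" using p by simp
    moreover have "0 \<le> (g 0 - g p) * norm y" using \<open>g p \<le> g 0\<close> by simp
    ultimately show ?thesis by linarith
  next
    case False
    define r where "r = norm y"
    have "1 < r" using False by (simp add: r_def)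
    have "g p \<le> g ((1 - 1/r) *\<^sub>R 0 + (1/r) *\<^sub>R y)"
      by (rule p) (use \<open>1 < r\<close> in \<open>simp add: r_def\<close>)
    also have "\<dots> \<le> (1 - 1/r) * g 0 + (1/r) * g y"
      by (rule convex_onD[OF conv]) (use \<open>1 < r\<close> in auto)
    finally have "r * g p \<le> r * ((1 - 1/r) * g 0 + (1/r) * g y)"
      using \<open>1 < r\<close> by (intro mult_left_mono) auto
    also have "\<dots> = (r - 1) * g 0 + g y"
      using \<open>1 < r\<close> by (simp add: field_simps)
    finally have "g y \<ge> g 0 - (g 0 - g p) * r" by (simp add: algebra_simps)
    then show ?thesis using \<open>g p \<le> g 0\<close> by (simp add: r_def)
  qed
  then show ?thesis by (rule that)
qed

text \<open>A convex function decreases at most linearly, so the quadratic wins. This provides the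
  proximal points of the Moreau envelope (\<open>v = 0\<close>) and of the ASVRG update.\<close>

lemma convex_plus_quadratic_attains_inf:
  fixes g :: "'a::euclidean_space \<Rightarrow> real"
  assumes conv: "convex_on UNIV g" and "0 < \<kappa>"
  shows "\<exists>p. \<forall>u. v \<bullet> (p - a) + \<kappa> * (norm (p - a))\<^sup>2 + g p \<le> v \<bullet> (u - a) + \<kappa> * (norm (u - a))\<^sup>2 + g u"
proof -
  obtain c M where cM: "\<And>y. g y \<ge> c - M * norm y"
    using convex_on_linear_lower_bound[OF conv] by blast
  show ?thesis
  proof (rule attains_inf_of_quadratic_growth[where \<kappa> = \<kappa> and c = "c - v \<bullet> a" 
        and M = "M + norm (v - (2 * \<kappa>) *\<^sub>R a)"])
    show "continuous_on UNIV (\<lambda>u. v \<bullet> (u - a) + \<kappa> * (norm (u - a))\<^sup>2 + g u)"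
      by (intro continuous_intros convex_on_continuous[OF open_UNIV conv])
    fix u
    have "\<bar>(v - (2 * \<kappa>) *\<^sub>R a) \<bullet> u\<bar> \<le> norm (v - (2 * \<kappa>) *\<^sub>R a) * norm u"
      by (rule Cauchy_Schwarz_ineq2)
    moreover have "v \<bullet> (u - a) + \<kappa> * (norm (u - a))\<^sup>2 
        = (v - (2 * \<kappa>) *\<^sub>R a) \<bullet> u - v \<bullet> a + \<kappa> * (norm u)\<^sup>2 + \<kappa> * (norm a)\<^sup>2"
      by (simp add: power2_norm_eq_inner inner_simps inner_commute algebra_simps)
    moreover have "0 \<le> \<kappa> * (norm a)\<^sup>2" using \<open>0 < \<kappa>\<close> by simp
    ultimately show "c - v \<bullet> a - (M + norm (v - (2 * \<kappa>) *\<^sub>R a)) * norm u + \<kappa> * (norm u)\<^sup>2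
        \<le> v \<bullet> (u - a) + \<kappa> * (norm (u - a))\<^sup>2 + g u"
      using cM[of u] by (simp add: algebra_simps)
  qed fact
qed

section \<open>Optimality conditions\<close>

text \<open>If the subgradient inequality failed at \<open>y\<close>, moving a small fraction
  \<open>t\<close> from \<open>p\<close> towards \<open>y\<close> would gain order \<open>t\<close>
  in \<open>q + g\<close> and lose only order \<open>t\<^sup>2\<close>. A quadratic upper bound on
  \<open>q\<close> at \<open>p\<close> takes the place of a derivative.\<close>

lemma subgradient_of_minimizer:
  fixes g q :: "'a::euclidean_space \<Rightarrow> real"
  assumes conv: "convex_on UNIV g"
    and smooth: "\<And>y. q y \<le> q p + d \<bullet> (y - p) + \<kappa> * (norm (y - p))\<^sup>2"
    and min: "\<And>y. q p + g p \<le> q y + g y"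
  shows "- d \<in> subdifferential g p"
proof -
  have "g p + (- d) \<bullet> (y - p) \<le> g y" for y
  proof (rule ccontr)
    define A B where "A = g p + (- d) \<bullet> (y - p) - g y" and "B = \<kappa> * (norm (y - p))\<^sup>2"
    assume "\<not> ?thesis"
    then have "0 < A" by (simp add: A_def)
    \<comment> \<open>Small enough that \<open>t * (\<bar>B\<bar> + 1)\<close> is at most
      \<open>A / 2\<close>, and capped at 1 to stay on the segment.\<close>
    define t where "t = min 1 (A / (2 * (\<bar>B\<bar> + 1)))"
    have t: "0 < t" "t \<le> 1" using \<open>0 < A\<close> by (auto simp: t_def)
    have "g p + q p \<le> q ((1 - t) *\<^sub>R p + t *\<^sub>R y) + g ((1 - t) *\<^sub>R p + t *\<^sub>R y)"
      using min by (simp add: add.commute)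
    also have "g ((1 - t) *\<^sub>R p + t *\<^sub>R y) \<le> (1 - t) * g p + t * g y"
      by (rule convex_onD[OF conv]) (use t in auto)
    also have "q ((1 - t) *\<^sub>R p + t *\<^sub>R y) \<le> q p + t * (d \<bullet> (y - p)) + t\<^sup>2 * B"
    proof -
      have "(1 - t) *\<^sub>R p + t *\<^sub>R y - p = t *\<^sub>R (y - p)" by (simp add: algebra_simps)
      then show ?thesis
        using smooth[of "(1 - t) *\<^sub>R p + t *\<^sub>R y"]
        by (simp only: B_def) (simp add: power_mult_distrib mult_ac)
    qed
    finally have "t * A \<le> t * (t * B)"
      by (simp add: A_def algebra_simps power2_eq_square)
    then have "A \<le> t * B" using t by simp
    also have "\<dots> \<le> t * (\<bar>B\<bar> + 1)" using t by (intro mult_left_mono) auto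
    also have "\<dots> \<le> A / (2 * (\<bar>B\<bar> + 1)) * (\<bar>B\<bar> + 1)"
      by (intro mult_right_mono) (auto simp: t_def)
    also have "\<dots> = A / 2" by (simp add: field_simps)
    finally show False using \<open>0 < A\<close> by simp
  qed
  then show ?thesis by (simp add: subdifferential_def)
qed

lemma subgradient_of_quadratic_minimizer:
  fixes g :: "'a::euclidean_space \<Rightarrow> real"
  assumes conv: "convex_on UNIV g"
    and min: "\<And>u. v \<bullet> (p - a) + \<kappa> * (norm (p - a))\<^sup>2 + g p \<le> v \<bullet> (u - a) + \<kappa> * (norm (u - a))\<^sup>2 + g u"
  shows "- (v + (2 * \<kappa>) *\<^sub>R (p - a)) \<in> subdifferential g p"
proof (rule subgradient_of_minimizer[OF conv])
  show "v \<bullet> (y - a) + \<kappa> * (norm (y - a))\<^sup>2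
      \<le> v \<bullet> (p - a) + \<kappa> * (norm (p - a))\<^sup>2 + (v + (2 * \<kappa>) *\<^sub>R (p - a)) \<bullet> (y - p) + \<kappa> * (norm (y - p))\<^sup>2" for y
    by (simp add: power2_norm_eq_inner inner_simps inner_commute algebra_simps)
qed (rule min)

text \<open>The squared gradient difference in the lower bound is what controls the variance of the
  stochastic gradients.\<close>

definition convex_smooth :: "real \<Rightarrow> ('a::euclidean_space \<Rightarrow> real) \<Rightarrow> bool" where
  "convex_smooth L \<phi> \<longleftrightarrow> (\<forall>x y.
     \<phi> y \<ge> \<phi> x + gradient \<phi> x \<bullet> (y - x) + 1 / (2 * L) * (norm (gradient \<phi> x - gradient \<phi> y))\<^sup>2 \<and>
     \<phi> y \<le> \<phi> x + gradient \<phi> x \<bullet> (y - x) + L / 2 * (norm (y - x))\<^sup>2)"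

section \<open>Gradients and convexity\<close>

text \<open>\<open>gradient\<close> is a definite description, so both existence and uniqueness of
  the derivative matter. A quadratic error is of lower order than the distance; a second candidate
  is compared in the direction of the difference.\<close>

lemma gradient_eqI:
  fixes \<phi> :: "'a::euclidean_space \<Rightarrow> real"
  assumes "\<And>y. \<bar>\<phi> y - \<phi> x - D \<bullet> (y - x)\<bar> \<le> K * (norm (y - x))\<^sup>2"
  shows "gradient \<phi> x = D"
proof -
  have "((\<lambda>y. (1 / norm (y - x)) *\<^sub>R (\<phi> y - (\<phi> x + (y - x) \<bullet> D))) \<longlongrightarrow> 0) (at x)"
  proof (rule Lim_null_comparison)
    show "\<forall>\<^sub>F y in at x. norm ((1 / norm (y - x)) *\<^sub>R (\<phi> y - (\<phi> x + (y - x) \<bullet> D))) \<le> K * norm (y - x)"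
    proof (rule eventually_at_filter[THEN iffD2], rule always_eventually, intro allI impI)
      fix y assume "y \<noteq> x"
      then have "norm (y - x) > 0" by simp
      moreover have "\<bar>\<phi> y - (\<phi> x + (y - x) \<bullet> D)\<bar> \<le> K * norm (y - x) * norm (y - x)"
        using assms[of y] by (simp add: power2_eq_square inner_commute algebra_simps)
      ultimately show "norm ((1 / norm (y - x)) *\<^sub>R (\<phi> y - (\<phi> x + (y - x) \<bullet> D))) \<le> K * norm (y - x)"
        by (simp add: pos_divide_le_eq)
    qed
    have "((\<lambda>y. K * norm (y - x)) \<longlongrightarrow> K * norm (x - x)) (at x)"
      by (intro tendsto_intros)
    then show "((\<lambda>y. K * norm (y - x)) \<longlongrightarrow> 0) (at x)" by simp
  qed
  then have deriv: "GDERIV \<phi> x :> D"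
    unfolding gderiv_def has_derivative_at2 by (auto intro: bounded_linear_inner_left)
  have "E = D" if "GDERIV \<phi> x :> E" for E
  proof -
    have "(\<lambda>h. h \<bullet> E) = (\<lambda>h. h \<bullet> D)"
      using has_derivative_unique that deriv unfolding gderiv_def by blast
    then have "(E - D) \<bullet> E = (E - D) \<bullet> D" by meson
    then have "(E - D) \<bullet> (E - D) = 0" by (simp add: inner_diff_right)
    then show ?thesis by simp
  qed
  then show ?thesis unfolding gradient_def using deriv by (intro the_equality)
qed

lemma convex_on_of_gradient_inequality:
  fixes \<phi> :: "'a::euclidean_space \<Rightarrow> real"
  assumes "\<And>x y. \<phi> x + D x \<bullet> (y - x) \<le> \<phi> y"
  shows "convex_on UNIV \<phi>"
proof (rule convex_onI)
  fix t :: real and x y :: 'a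
  assume t: "0 < t" "t < 1"
  define w where "w = (1 - t) *\<^sub>R x + t *\<^sub>R y"
  have "(1 - t) * (\<phi> w + D w \<bullet> (x - w)) + t * (\<phi> w + D w \<bullet> (y - w)) \<le> (1 - t) * \<phi> x + t * \<phi> y"
    by (intro add_mono mult_left_mono assms) (use t in auto)
  moreover have "(1 - t) * (\<phi> w + D w \<bullet> (x - w)) + t * (\<phi> w + D w \<bullet> (y - w)) = \<phi> w + D w \<bullet> ((1 - t) *\<^sub>R x + t *\<^sub>R y - w)"
    by (simp add: algebra_simps inner_simps)
  ultimately show "\<phi> ((1 - t) *\<^sub>R x + t *\<^sub>R y) \<le> (1 - t) * \<phi> x + t * \<phi> y"
    by (simp add: w_def)
qed auto

lemma convex_smooth_gradient_inequality:
  assumes "convex_smooth L \<phi>" "0 < L"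
  shows "\<phi> x + gradient \<phi> x \<bullet> (y - x) \<le> \<phi> y"
proof -
  have "0 \<le> 1 / (2 * L) * (norm (gradient \<phi> x - gradient \<phi> y))\<^sup>2" using \<open>0 < L\<close> by simp
  then show ?thesis using assms unfolding convex_smooth_def by (smt (verit))
qed

section \<open>Moreau envelopes\<close>

text \<open>The last property is the optimality condition at the proximal point;
  \<open>\<delta> *\<^sub>R (x - p)\<close> turns out to be the gradient of the envelope at
  \<open>x\<close>.\<close>

lemma moreau_envelope_attained:
  fixes f :: "'a::euclidean_space \<Rightarrow> real"
  assumes conv: "convex_on UNIV f" and "0 < \<delta>"
  obtains p where "moreau_envelope \<delta> f x = f p + \<delta> / 2 * (norm (x - p))\<^sup>2"
    and "\<And>y. f p + \<delta> / 2 * (norm (x - p))\<^sup>2 \<le> f y + \<delta> / 2 * (norm (x - y))\<^sup>2"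
    and "\<delta> *\<^sub>R (x - p) \<in> subdifferential f p"
proof -
  obtain p where p: "\<And>u. 0 \<bullet> (p - x) + \<delta>/2 * (norm (p - x))\<^sup>2 + f p \<le> 0 \<bullet> (u - x) + \<delta>/2 * (norm (u - x))\<^sup>2 + f u"
    using convex_plus_quadratic_attains_inf[OF conv, of "\<delta>/2" 0 x] \<open>0 < \<delta>\<close> by auto
  have min: "f p + \<delta> / 2 * (norm (x - p))\<^sup>2 \<le> f y + \<delta> / 2 * (norm (x - y))\<^sup>2" for y
    using p[of y] by (simp add: norm_minus_commute add.commute)
  moreover have "moreau_envelope \<delta> f x = f p + \<delta> / 2 * (norm (x - p))\<^sup>2"
    unfolding moreau_envelope_def
    by (rule cInf_eq_minimum) (use min in auto)
  moreover have "\<delta> *\<^sub>R (x - p) \<in> subdifferential f p"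
    using subgradient_of_quadratic_minimizer[OF conv p] by (simp add: scaleR_diff_right)
  ultimately show ?thesis using that by blast
qed

text \<open>With \<open>D x\<close> the scaled displacement to the proximal point, both inequalities
  are first shown for \<open>D\<close>; together they force \<open>D\<close> to be the
  gradient.\<close>

lemma convex_smooth_moreau_envelope:
  fixes f :: "'a::euclidean_space \<Rightarrow> real"
  assumes conv: "convex_on UNIV f" and "0 < \<delta>"
  shows "convex_smooth \<delta> (moreau_envelope \<delta> f)"
proof -
  define F where "F = moreau_envelope \<delta> f"
  have "\<exists>p. \<forall>x. F x = f (p x) + \<delta> / 2 * (norm (x - p x))\<^sup>2 \<and>
      (\<forall>y. F x \<le> f y + \<delta> / 2 * (norm (x - y))\<^sup>2) \<and> \<delta> *\<^sub>R (x - p x) \<in> subdifferential f (p x)"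
    unfolding F_def by (intro choice allI) (use moreau_envelope_attained[OF assms] in metis)
  then obtain p where F: "F x = f (p x) + \<delta> / 2 * (norm (x - p x))\<^sup>2"
    and le: "F x \<le> f y + \<delta> / 2 * (norm (x - y))\<^sup>2"
    and sub: "\<delta> *\<^sub>R (x - p x) \<in> subdifferential f (p x)" for x y
    by blast
  define D where "D x = \<delta> *\<^sub>R (x - p x)" for x
  \<comment> \<open>The proximal point of \<open>x\<close> is a competitor in the infimum at
    \<open>y\<close>.\<close>
  have upper: "F y \<le> F x + D x \<bullet> (y - x) + \<delta> / 2 * (norm (y - x))\<^sup>2" for x y
    using le[of y "p x"] F[of x] unfolding D_def
    by (simp add: power2_norm_eq_inner inner_simps inner_commute algebra_simps)
  have lower: "F y \<ge> F x + D x \<bullet> (y - x) + 1 / (2 * \<delta>) * (norm (D x - D y))\<^sup>2" for x y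
  proof -
    have "f (p y) \<ge> f (p x) + D x \<bullet> (p y - p x)"
      using sub[of x] by (simp add: subdifferential_def D_def)
    moreover have "1 / (2 * \<delta>) * (norm (D x - D y))\<^sup>2 = \<delta> / 2 * (norm ((x - p x) - (y - p y)))\<^sup>2"
    proof -
      have "D x - D y = \<delta> *\<^sub>R ((x - p x) - (y - p y))" by (simp add: D_def algebra_simps)
      then have "(norm (D x - D y))\<^sup>2 = \<delta>\<^sup>2 * (norm ((x - p x) - (y - p y)))\<^sup>2"
        by (simp only: norm_scaleR power_mult_distrib) simp
      then show ?thesis using \<open>0 < \<delta>\<close> by (simp add: power2_eq_square)
    qed
    \<comment> \<open>Completing the square: what remains beyond the linear term is exactly the
      squared gradient difference.\<close>
    moreover have "D x \<bullet> (p y - p x) + \<delta> / 2 * (norm (y - p y))\<^sup>2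
       = \<delta> / 2 * (norm (x - p x))\<^sup>2 + D x \<bullet> (y - x) + \<delta> / 2 * (norm ((x - p x) - (y - p y)))\<^sup>2"
      unfolding D_def
      by (simp add: power2_norm_eq_inner inner_simps inner_commute algebra_simps)
    ultimately show ?thesis using F[of x] F[of y] by linarith
  qed
  have "gradient F x = D x" for x
  proof (rule gradient_eqI)
    fix y
    have "0 \<le> 1 / (2 * \<delta>) * (norm (D x - D y))\<^sup>2" "0 \<le> \<delta> / 2 * (norm (y - x))\<^sup>2" using \<open>0 < \<delta>\<close> by auto
    then show "\<bar>F y - F x - D x \<bullet> (y - x)\<bar> \<le> \<delta> / 2 * (norm (y - x))\<^sup>2"
      using upper[of y x] lower[of x y] by linarith
  qed
  then show ?thesis using upper lower unfolding convex_smooth_def F_def by auto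
qed

lemma moreau_envelope_le:
  fixes f :: "'a::euclidean_space \<Rightarrow> real"
  assumes "convex_on UNIV f" and "0 < \<delta>"
  shows "moreau_envelope \<delta> f x \<le> f x"
proof (rule moreau_envelope_attained[OF assms, of x])
  fix p
  assume "moreau_envelope \<delta> f x = f p + \<delta> / 2 * (norm (x - p))\<^sup>2"
    and "\<And>y. f p + \<delta> / 2 * (norm (x - p))\<^sup>2 \<le> f y + \<delta> / 2 * (norm (x - y))\<^sup>2"
  from this(1) this(2)[of x] show ?thesis by simp
qed

lemma moreau_envelope_mono:
  fixes f :: "'a::euclidean_space \<Rightarrow> real"
  assumes "convex_on UNIV f" and "0 < \<delta>" and "\<delta> \<le> \<delta>'"
  shows "moreau_envelope \<delta> f x \<le> moreau_envelope \<delta>' f x"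
proof (rule moreau_envelope_attained[OF assms(1,2), of x], rule moreau_envelope_attained[OF assms(1), of \<delta>' x])
  show "0 < \<delta>'" using assms by simp
  fix p p'
  assume "moreau_envelope \<delta> f x = f p + \<delta> / 2 * (norm (x - p))\<^sup>2"
    and "\<And>y. f p + \<delta> / 2 * (norm (x - p))\<^sup>2 \<le> f y + \<delta> / 2 * (norm (x - y))\<^sup>2"
    and "moreau_envelope \<delta>' f x = f p' + \<delta>' / 2 * (norm (x - p'))\<^sup>2"
  moreover have "\<delta> / 2 * (norm (x - p'))\<^sup>2 \<le> \<delta>' / 2 * (norm (x - p'))\<^sup>2"
    by (rule mult_right_mono) (use \<open>\<delta> \<le> \<delta>'\<close> in auto)
  ultimately show ?thesis by (smt (verit))
qed

text \<open>A proximal point at distance \<open>r\<close> lowers \<open>f\<close> by at most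
  \<open>G * r\<close> and costs \<open>\<delta> / 2 * r\<^sup>2\<close>; the difference is largest
  at \<open>r = G / \<delta>\<close>.\<close>

lemma le_moreau_envelope_plus:
  fixes f :: "'a::euclidean_space \<Rightarrow> real"
  assumes "convex_on UNIV f" and lip: "G-lipschitz_on UNIV f" and "0 < \<delta>"
  shows "f x \<le> moreau_envelope \<delta> f x + G\<^sup>2 / (2 * \<delta>)"
proof (rule moreau_envelope_attained[OF assms(1,3), of x])
  fix p assume env: "moreau_envelope \<delta> f x = f p + \<delta> / 2 * (norm (x - p))\<^sup>2"
  have "f x - f p \<le> G * norm (x - p)"
    using lipschitz_onD[OF lip, of x p] by (simp add: dist_norm)
  moreover have "G * norm (x - p) \<le> \<delta> / 2 * (norm (x - p))\<^sup>2 + G\<^sup>2 / (2 * \<delta>)"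
  proof -
    have "0 \<le> (\<delta> * norm (x - p) - G)\<^sup>2 / (2 * \<delta>)" using \<open>0 < \<delta>\<close> by simp
    also have "\<dots> = \<delta> / 2 * (norm (x - p))\<^sup>2 + G\<^sup>2 / (2 * \<delta>) - G * norm (x - p)"
      using \<open>0 < \<delta>\<close> by (simp add: field_simps power2_eq_square)
    finally show ?thesis by linarith
  qed
  ultimately show ?thesis using env by linarith
qed

text \<open>The quadratic bound is available only where a subgradient exists; the minimizer of
  \<open>g\<close> plus the squared norm is such a point.\<close>

lemma strongly_convex_minorant:
  fixes g :: "'a::euclidean_space \<Rightarrow> real"
  assumes "strongly_convex \<mu> g"
  obtains p \<xi> where "\<And>y. g y \<ge> g p + \<xi> \<bullet> (y - p) + \<mu> / 2 * (norm (p - y))\<^sup>2"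
proof -
  have conv: "convex_on UNIV g" using assms by (simp add: strongly_convex_def)
  obtain p where p: "\<And>u. 0 \<bullet> (p - 0) + 1 * (norm (p - 0))\<^sup>2 + g p \<le> 0 \<bullet> (u - 0) + 1 * (norm (u - 0))\<^sup>2 + g u"
    using convex_plus_quadratic_attains_inf[OF conv zero_less_one, of 0 0] by blast
  have "- (0 + (2 * 1) *\<^sub>R (p - 0)) \<in> subdifferential g p"
    by (rule subgradient_of_quadratic_minimizer[OF conv p])
  then show ?thesis using assms that unfolding strongly_convex_def by blast
qed

subsection \<open>Progress of one ASVRG step\<close>

definition average :: "nat \<Rightarrow> (nat \<Rightarrow> 'b::real_vector) \<Rightarrow> 'b" where
  "average n a = (1 / real n) *\<^sub>R (\<Sum>i<n. a i)"

lemma average_add: "average n (\<lambda>i. a i + b i) = average n a + average n b"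
  by (simp add: average_def sum.distrib scaleR_add_right)

lemma average_diff: "average n (\<lambda>i. a i - b i) = average n a - average n b"
  by (simp add: average_def sum_subtractf scaleR_diff_right)

lemma average_const: "1 \<le> n \<Longrightarrow> average n (\<lambda>i. a) = a"
  by (simp add: average_def scaleR_left.sum[symmetric] scaleR_scaleR[symmetric] del: scaleR_scaleR)
     (simp add: sum_constant_scaleR)

lemma average_mult_left: "average n (\<lambda>i. (c::real) * a i) = c * average n a"
  by (simp add: average_def sum_distrib_left)

lemma average_inner_left: "average n (\<lambda>i. u i \<bullet> w) = average n u \<bullet> w"
  by (simp add: average_def inner_sum_left)

lemma average_mono: "(\<And>i. i < n \<Longrightarrow> a i \<le> b i) \<Longrightarrow> average n a \<le> (average n b :: real)"
  by (auto simp: average_def intro!: divide_right_mono sum_mono)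

text \<open>The variance is the second moment minus the squared norm of the mean.\<close>

lemma average_variance_le:
  fixes u :: "nat \<Rightarrow> 'a::real_inner"
  assumes "1 \<le> n"
  shows "average n (\<lambda>i. (norm (average n u - u i))\<^sup>2) \<le> average n (\<lambda>i. (norm (u i))\<^sup>2)"
proof -
  define v where "v = average n u"
  have "(norm (v - u i))\<^sup>2 = (norm (u i))\<^sup>2 + (v \<bullet> v - 2 * (u i \<bullet> v))" for i
    by (simp add: power2_norm_eq_inner inner_simps inner_commute)
  then have "average n (\<lambda>i. (norm (v - u i))\<^sup>2) = average n (\<lambda>i. (norm (u i))\<^sup>2) + (v \<bullet> v - 2 * (v \<bullet> v))"
    using assms by (simp add: average_add average_diff average_const average_mult_left average_inner_left v_def[symmetric])
  then show ?thesis by (simp add: v_def)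
qed

lemma objective_eq_average: "objective n \<phi> h x = average n (\<lambda>i. \<phi> i x) + h x"
  by (simp add: objective_def average_def)

lemma full_gradient_eq_average: "full_gradient n \<phi> x = average n (\<lambda>i. gradient (\<phi> i) x)"
  by (simp add: full_gradient_def average_def)

section \<open>The composite objective\<close>

text \<open>The setting of a single smoothing round, later instantiated with the envelopes as
  \<open>\<phi>\<close> and \<open>L = \<delta>0 * 2 ^ t\<close>.\<close>

locale asvrg_problem =
  fixes n m :: nat and \<phi> :: "nat \<Rightarrow> 'a::euclidean_space \<Rightarrow> real" and h :: "'a \<Rightarrow> real"
    and L \<mu> \<eta> \<omega> :: real
  assumes n: "1 \<le> n" and L: "0 < L" and \<mu>: "0 < \<mu>"
    and smooth: "\<And>i. i < n \<Longrightarrow> convex_smooth L (\<phi> i)"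
    and h: "strongly_convex \<mu> h"
    and parameters: "asvrg_parameters L \<eta> \<omega> m"
begin

abbreviation "F \<equiv> objective n \<phi> h"

definition \<Phi> :: "'a \<Rightarrow> real" where "\<Phi> x = average n (\<lambda>i. \<phi> i x)"

lemma F_eq: "F x = \<Phi> x + h x"
  by (simp add: objective_eq_average \<Phi>_def)

lemma \<eta>: "0 < \<eta>" "L * \<eta> < 1" and \<omega>: "0 < \<omega>" "\<omega> \<le> 1 - L * \<eta> / (1 - L * \<eta>)" and m: "1 \<le> m"
  using parameters L by (auto simp: asvrg_parameters_def field_simps)

lemma \<omega>_lt_1: "\<omega> < 1"
proof -
  have "0 < L * \<eta> / (1 - L * \<eta>)" using L \<eta> by simp
  then show ?thesis using \<omega> by linarith
qed

lemma h_convex: "convex_on UNIV h"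
  using h by (simp add: strongly_convex_def)

lemma \<Phi>_lower: "\<Phi> x + full_gradient n \<phi> x \<bullet> (y - x) \<le> \<Phi> y"
proof -
  have "average n (\<lambda>i. \<phi> i x + gradient (\<phi> i) x \<bullet> (y - x)) \<le> \<Phi> y"
    unfolding \<Phi>_def by (intro average_mono convex_smooth_gradient_inequality[OF smooth L])
  then show ?thesis
    by (simp add: average_add average_inner_left full_gradient_eq_average \<Phi>_def)
qed

lemma \<Phi>_upper: "\<Phi> y \<le> \<Phi> x + full_gradient n \<phi> x \<bullet> (y - x) + L / 2 * (norm (y - x))\<^sup>2"
proof -
  have "\<Phi> y \<le> average n (\<lambda>i. \<phi> i x + gradient (\<phi> i) x \<bullet> (y - x) + L / 2 * (norm (y - x))\<^sup>2)"
    unfolding \<Phi>_def by (intro average_mono) (use smooth in \<open>auto simp: convex_smooth_def\<close>)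
  then show ?thesis
    by (simp add: average_add average_inner_left average_const[OF n] full_gradient_eq_average \<Phi>_def)
qed

text \<open>The error of the gradient estimate at \<open>x\<close> is \<open>u i\<close> minus its
  mean, up to sign. Centring can only shrink the second moment, and the lower bound in
  \<open>convex_smooth\<close> turns each \<open>(norm (u i))\<^sup>2\<close> into a Bregman
  distance.\<close>

lemma \<Phi>_gradient_variance:
  "average n (\<lambda>i. (norm (full_gradient n \<phi> x - (gradient (\<phi> i) x - gradient (\<phi> i) z + full_gradient n \<phi> z)))\<^sup>2)
    \<le> 2 * L * (\<Phi> z - \<Phi> x - full_gradient n \<phi> x \<bullet> (z - x))"
proof -
  define u where "u i = gradient (\<phi> i) x - gradient (\<phi> i) z" for i
  have "full_gradient n \<phi> x - (gradient (\<phi> i) x - gradient (\<phi> i) z + full_gradient n \<phi> z) = average n u - u i" for i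
    by (simp add: u_def[abs_def] average_diff full_gradient_eq_average)
  then have "average n (\<lambda>i. (norm (full_gradient n \<phi> x - (gradient (\<phi> i) x - gradient (\<phi> i) z + full_gradient n \<phi> z)))\<^sup>2)
      \<le> average n (\<lambda>i. (norm (u i))\<^sup>2)"
    using average_variance_le[OF n, of u] by simp
  also have "\<dots> \<le> average n (\<lambda>i. 2 * L * (\<phi> i z - \<phi> i x - gradient (\<phi> i) x \<bullet> (z - x)))"
  proof (rule average_mono)
    fix i assume "i < n"
    then have "1 / (2 * L) * (norm (u i))\<^sup>2 \<le> \<phi> i z - \<phi> i x - gradient (\<phi> i) x \<bullet> (z - x)"
      using smooth[of i] unfolding convex_smooth_def u_def by (smt (verit))
    then have "2 * L * (1 / (2 * L) * (norm (u i))\<^sup>2) \<le> 2 * L * (\<phi> i z - \<phi> i x - gradient (\<phi> i) x \<bullet> (z - x))"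
      by (rule mult_left_mono) (use L in simp)
    then show "(norm (u i))\<^sup>2 \<le> 2 * L * (\<phi> i z - \<phi> i x - gradient (\<phi> i) x \<bullet> (z - x))"
      using L by simp
  qed
  also have "\<dots> = 2 * L * (\<Phi> z - \<Phi> x - full_gradient n \<phi> x \<bullet> (z - x))"
    by (simp add: average_mult_left average_diff average_inner_left full_gradient_eq_average \<Phi>_def)
  finally show ?thesis .
qed

lemma F_convex: "convex_on UNIV F"
  unfolding F_eq[abs_def]
  by (intro convex_on_add h_convex convex_on_of_gradient_inequality[OF \<Phi>_lower])

text \<open>At a minimizer the negative gradient of \<open>\<Phi>\<close> is a subgradient of
  \<open>h\<close>, so adding the strong convexity bound of \<open>h\<close> to the tangent bound of
  \<open>\<Phi>\<close> cancels the linear terms.\<close>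

lemma F_minimizer_growth:
  assumes "\<And>y. F w \<le> F y"
  shows "\<mu> / 2 * (norm (w - y))\<^sup>2 \<le> F y - F w"
proof -
  have "- full_gradient n \<phi> w \<in> subdifferential h w"
    by (rule subgradient_of_minimizer[OF h_convex \<Phi>_upper]) (use assms in \<open>simp add: F_eq\<close>)
  then have "h y \<ge> h w + (- full_gradient n \<phi> w) \<bullet> (y - w) + \<mu> / 2 * (norm (w - y))\<^sup>2"
    using h unfolding strongly_convex_def by blast
  then show ?thesis using \<Phi>_lower[of w y] by (simp add: F_eq)
qed

lemma F_attains_inf: "\<exists>w. \<forall>y. F w \<le> F y"
proof -
  obtain p \<xi> where p: "\<And>y. h y \<ge> h p + \<xi> \<bullet> (y - p) + \<mu> / 2 * (norm (p - y))\<^sup>2"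
    using strongly_convex_minorant[OF h] by blast
  define d where "d = full_gradient n \<phi> p + \<xi>"
  have low: "F y \<ge> F p + d \<bullet> (y - p) + \<mu> / 2 * (norm (y - p))\<^sup>2" for y
    using p[of y] \<Phi>_lower[of p y] by (simp add: F_eq d_def inner_add_left norm_minus_commute)
  show ?thesis
  proof (rule attains_inf_of_quadratic_growth[where \<kappa> = "\<mu> / 2" and c = "F p - d \<bullet> p" and M = "norm (d - \<mu> *\<^sub>R p)"])
    show "continuous_on UNIV F" by (rule convex_on_continuous[OF open_UNIV F_convex])
    fix y
    have "\<bar>(d - \<mu> *\<^sub>R p) \<bullet> y\<bar> \<le> norm (d - \<mu> *\<^sub>R p) * norm y"
      by (rule Cauchy_Schwarz_ineq2)
    moreover have "d \<bullet> (y - p) + \<mu> / 2 * (norm (y - p))\<^sup>2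
        = (d - \<mu> *\<^sub>R p) \<bullet> y - d \<bullet> p + \<mu> / 2 * (norm y)\<^sup>2 + \<mu> / 2 * (norm p)\<^sup>2"
      by (simp add: power2_norm_eq_inner inner_simps inner_commute algebra_simps)
    moreover have "0 \<le> \<mu> / 2 * (norm p)\<^sup>2" using \<mu> by simp
    ultimately show "F p - d \<bullet> p - norm (d - \<mu> *\<^sub>R p) * norm y + \<mu> / 2 * (norm y)\<^sup>2 \<le> F y"
      using low[of y] by linarith
  qed (use \<mu> in simp)
qed

section \<open>The proximal step and its expected progress\<close>

text \<open>The variance-reduced gradient estimate; its average over \<open>i\<close> is the full
  gradient at \<open>x\<close>.\<close>

definition v :: "'a \<Rightarrow> 'a \<Rightarrow> nat \<Rightarrow> 'a" where
  "v z x i = gradient (\<phi> i) x - gradient (\<phi> i) z + full_gradient n \<phi> z"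

definition prox :: "'a \<Rightarrow> 'a \<Rightarrow> 'a \<Rightarrow> nat \<Rightarrow> 'a" where
  "prox z x y i = (ARG_MIN (\<lambda>u. v z x i \<bullet> (u - y) + \<omega> / (2 * \<eta>) * (norm (u - y))\<^sup>2 + h u) u. True)"

text \<open>The subgradient inequality of \<open>h\<close> at the proximal point, tested at
  \<open>w\<close>; the inner product with the displacement expands into three squared
  distances.\<close>

lemma prox_three_point:
  "v z x i \<bullet> (prox z x y i - y) + \<omega> / (2 * \<eta>) * (norm (prox z x y i - y))\<^sup>2 + h (prox z x y i)
    \<le> v z x i \<bullet> (w - y) + \<omega> / (2 * \<eta>) * ((norm (w - y))\<^sup>2 - (norm (w - prox z x y i))\<^sup>2) + h w"
proof -
  define \<kappa> p where "\<kappa> = \<omega> / (2 * \<eta>)" and "p = prox z x y i"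
  have "0 < \<kappa>" using \<omega> \<eta> by (simp add: \<kappa>_def)
  have "\<forall>u. v z x i \<bullet> (p - y) + \<kappa> * (norm (p - y))\<^sup>2 + h p
      \<le> v z x i \<bullet> (u - y) + \<kappa> * (norm (u - y))\<^sup>2 + h u"
  proof -
    have "\<exists>p. is_arg_min (\<lambda>u. v z x i \<bullet> (u - y) + \<kappa> * (norm (u - y))\<^sup>2 + h u) (\<lambda>_. True) p"
      using convex_plus_quadratic_attains_inf[OF h_convex \<open>0 < \<kappa>\<close>, of "v z x i" y]
      by (simp add: is_arg_min_linorder)
    \<comment> \<open>\<open>ARG_MIN\<close> is a choice operator, so it yields a minimizer only
      because one was shown to exist.\<close>
    then have "is_arg_min (\<lambda>u. v z x i \<bullet> (u - y) + \<kappa> * (norm (u - y))\<^sup>2 + h u) (\<lambda>_. True) p"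
      unfolding p_def prox_def arg_min_def \<kappa>_def by (rule someI_ex)
    then show ?thesis by (simp add: is_arg_min_linorder)
  qed
  then have "- (v z x i + (2 * \<kappa>) *\<^sub>R (p - y)) \<in> subdifferential h p"
    by (intro subgradient_of_quadratic_minimizer h_convex) auto
  then have "h p + (- (v z x i + (2 * \<kappa>) *\<^sub>R (p - y))) \<bullet> (w - p) \<le> h w"
    by (simp add: subdifferential_def)
  moreover have "(- (v z x i + (2 * \<kappa>) *\<^sub>R (p - y))) \<bullet> (w - p)
     = v z x i \<bullet> (p - y) + \<kappa> * (norm (p - y))\<^sup>2
       - (v z x i \<bullet> (w - y) + \<kappa> * ((norm (w - y))\<^sup>2 - (norm (w - p))\<^sup>2))"
    by (simp add: power2_norm_eq_inner inner_simps inner_commute algebra_simps)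
  ultimately show ?thesis unfolding \<kappa>_def p_def by linarith
qed

lemma step_inequality:
  assumes x: "x = z + \<omega> *\<^sub>R (y - z)" and i: "i < n"
  defines "y' \<equiv> prox z x y i"
  defines "x' \<equiv> z + \<omega> *\<^sub>R (y' - z)"
  shows "F x' + \<omega>\<^sup>2 / (2 * \<eta>) * (norm (w - y'))\<^sup>2
    \<le> \<Phi> x + (1 - \<omega>) * h z + \<omega> * h w + \<omega> * (v z x i \<bullet> (w - y)) + \<omega>\<^sup>2 / (2 * \<eta>) * (norm (w - y))\<^sup>2
      + \<eta> / (2 * (1 - L * \<eta>)) * (norm (full_gradient n \<phi> x - v z x i))\<^sup>2"
proof -
  define e where "e = full_gradient n \<phi> x - v z x i"
  define r where "r = y' - y"
  \<comment> \<open>The coupling of \<open>x\<close> with \<open>y\<close> and \<open>z\<close>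
    makes the displacement of \<open>x\<close> exactly \<open>\<omega>\<close> times that of
    \<open>y\<close>.\<close>
  have x': "x' - x = \<omega> *\<^sub>R r" by (simp add: x'_def x r_def algebra_simps)
  have pos: "0 < 1 - L * \<eta>" using \<eta> by simp
  \<comment> \<open>Young's inequality with weight \<open>\<eta> / (1 - L * \<eta>)\<close>: its
    second term and the smoothness term \<open>L / 2\<close> add up to
    \<open>1 / (2 * \<eta>)\<close>, the coefficient that the proximal step offsets.\<close>
  have young: "\<omega> * (e \<bullet> r) \<le> \<eta> / (2 * (1 - L * \<eta>)) * (norm e)\<^sup>2 + (1 - L * \<eta>) / (2 * \<eta>) * (\<omega>\<^sup>2 * (norm r)\<^sup>2)"
  proof -
    define a where "a = \<eta> / (1 - L * \<eta>)"
    have "0 < a" using \<eta> pos by (simp add: a_def)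
    have "0 \<le> (norm (a *\<^sub>R e - \<omega> *\<^sub>R r))\<^sup>2 / (2 * a)" using \<open>0 < a\<close> by simp
    also have "\<dots> = (a\<^sup>2 * (norm e)\<^sup>2 - 2 * a * (\<omega> * (e \<bullet> r)) + \<omega>\<^sup>2 * (norm r)\<^sup>2) / (2 * a)"
      by (simp only: power2_norm_eq_inner)
        (simp add: inner_simps inner_commute power2_eq_square algebra_simps)
    also have "\<dots> = a / 2 * (norm e)\<^sup>2 - \<omega> * (e \<bullet> r) + 1 / (2 * a) * (\<omega>\<^sup>2 * (norm r)\<^sup>2)"
      using \<open>0 < a\<close> by (simp add: power2_eq_square field_simps)
    finally have "\<omega> * (e \<bullet> r) \<le> a / 2 * (norm e)\<^sup>2 + 1 / (2 * a) * (\<omega>\<^sup>2 * (norm r)\<^sup>2)" by linarith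
    then show ?thesis by (simp add: a_def mult.commute)
  qed
  have "\<Phi> x' \<le> \<Phi> x + \<omega> * (full_gradient n \<phi> x \<bullet> r) + L / 2 * (\<omega>\<^sup>2 * (norm r)\<^sup>2)"
    using \<Phi>_upper[of x' x] by (simp add: x' power_mult_distrib)
  also have "full_gradient n \<phi> x = v z x i + e" by (simp add: e_def)
  finally have "\<Phi> x' \<le> \<Phi> x + \<omega> * (v z x i \<bullet> r) + \<eta> / (2 * (1 - L * \<eta>)) * (norm e)\<^sup>2 + \<omega>\<^sup>2 / (2 * \<eta>) * (norm r)\<^sup>2"
  proof -
    assume "\<Phi> x' \<le> \<Phi> x + \<omega> * ((v z x i + e) \<bullet> r) + L / 2 * (\<omega>\<^sup>2 * (norm r)\<^sup>2)"
    moreover have "(1 - L * \<eta>) / (2 * \<eta>) * (\<omega>\<^sup>2 * (norm r)\<^sup>2) + L / 2 * (\<omega>\<^sup>2 * (norm r)\<^sup>2) = \<omega>\<^sup>2 / (2 * \<eta>) * (norm r)\<^sup>2"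
      using \<eta> by (simp add: field_simps)
    ultimately show ?thesis using young by (simp add: inner_add_left distrib_left)
  qed
  moreover have "h x' \<le> (1 - \<omega>) * h z + \<omega> * h y'"
  proof -
    have "x' = (1 - \<omega>) *\<^sub>R z + \<omega> *\<^sub>R y'" by (simp add: x'_def algebra_simps)
    then show ?thesis using convex_onD[OF h_convex, of \<omega> z y'] \<omega> \<omega>_lt_1 by simp
  qed
  moreover have "\<omega> * (v z x i \<bullet> r) + \<omega>\<^sup>2 / (2 * \<eta>) * (norm r)\<^sup>2 + \<omega> * h y'
    \<le> \<omega> * (v z x i \<bullet> (w - y)) + \<omega>\<^sup>2 / (2 * \<eta>) * (norm (w - y))\<^sup>2 - \<omega>\<^sup>2 / (2 * \<eta>) * (norm (w - y'))\<^sup>2 + \<omega> * h w"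
  proof -
    have "\<omega> * (v z x i \<bullet> r + \<omega> / (2 * \<eta>) * (norm r)\<^sup>2 + h y')
        \<le> \<omega> * (v z x i \<bullet> (w - y) + \<omega> / (2 * \<eta>) * ((norm (w - y))\<^sup>2 - (norm (w - y'))\<^sup>2) + h w)"
      unfolding r_def y'_def using \<omega> by (intro mult_left_mono prox_three_point) auto
    then show ?thesis by (simp add: power2_eq_square algebra_simps)
  qed
  ultimately show ?thesis unfolding F_eq e_def by linarith
qed

lemma expected_step_inequality:
  assumes x: "x = z + \<omega> *\<^sub>R (y - z)"
  shows "average n (\<lambda>i. F (z + \<omega> *\<^sub>R (prox z x y i - z)) + \<omega>\<^sup>2 / (2 * \<eta>) * (norm (w - prox z x y i))\<^sup>2)
    \<le> (1 - \<omega>) * F z + \<omega> * F w + \<omega>\<^sup>2 / (2 * \<eta>) * (norm (w - y))\<^sup>2"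
proof -
  define K where "K = \<Phi> z - \<Phi> x - full_gradient n \<phi> x \<bullet> (z - x)"
  define C where "C = \<Phi> x + (1 - \<omega>) * h z + \<omega> * h w + \<omega>\<^sup>2 / (2 * \<eta>) * (norm (w - y))\<^sup>2"
  have "0 \<le> K" using \<Phi>_lower[of x z] by (simp add: K_def)
  have mean: "average n (v z x) = full_gradient n \<phi> x"
    by (simp add: v_def[abs_def] average_add average_diff average_const[OF n] full_gradient_eq_average)
  have "average n (\<lambda>i. F (z + \<omega> *\<^sub>R (prox z x y i - z)) + \<omega>\<^sup>2 / (2 * \<eta>) * (norm (w - prox z x y i))\<^sup>2)
    \<le> average n (\<lambda>i. C + \<omega> * (v z x i \<bullet> (w - y))
        + \<eta> / (2 * (1 - L * \<eta>)) * (norm (full_gradient n \<phi> x - v z x i))\<^sup>2)"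
    using step_inequality[OF x] by (intro average_mono) (simp add: C_def algebra_simps)
  also have "\<dots> = C + \<omega> * (full_gradient n \<phi> x \<bullet> (w - y))
        + \<eta> / (2 * (1 - L * \<eta>)) * average n (\<lambda>i. (norm (full_gradient n \<phi> x - v z x i))\<^sup>2)"
    by (simp only: average_add average_const[OF n] average_mult_left average_inner_left mean)
  also have "\<dots> \<le> C + \<omega> * (full_gradient n \<phi> x \<bullet> (w - y)) + \<eta> / (2 * (1 - L * \<eta>)) * (2 * L * K)"
    using \<eta> \<Phi>_gradient_variance[of x z] unfolding v_def K_def
    by (intro add_left_mono mult_left_mono) auto
  also have "\<eta> / (2 * (1 - L * \<eta>)) * (2 * L * K) = L * \<eta> / (1 - L * \<eta>) * K"
    using \<eta> by (simp add: field_simps)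
  \<comment> \<open>This is where the upper bound on the momentum parameter enters.\<close>
  also have "\<dots> \<le> (1 - \<omega>) * K"
    using \<omega> \<open>0 \<le> K\<close> by (intro mult_right_mono) auto
  \<comment> \<open>Since \<open>x\<close> is the convex combination of \<open>z\<close> and
    \<open>y\<close> with weight \<open>\<omega>\<close>, the direction splits at \<open>x\<close>.
    The part towards \<open>z\<close> then cancels the linear term of
    \<open>(1 - \<omega>) * K\<close> and leaves \<open>(1 - \<omega>) * \<Phi> z\<close>.\<close>
  also have "\<omega> * (full_gradient n \<phi> x \<bullet> (w - y)) 
      = \<omega> * (full_gradient n \<phi> x \<bullet> (w - x)) + (1 - \<omega>) * (full_gradient n \<phi> x \<bullet> (z - x))"
    by (simp add: x inner_simps algebra_simps)
  also have "C + (\<omega> * (full_gradient n \<phi> x \<bullet> (w - x)) + (1 - \<omega>) * (full_gradient n \<phi> x \<bullet> (z - x))) + (1 - \<omega>) * K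
      = C - \<Phi> x + (1 - \<omega>) * \<Phi> z + \<omega> * (\<Phi> x + full_gradient n \<phi> x \<bullet> (w - x))"
    by (simp add: K_def algebra_simps)
  also have "\<dots> \<le> C - \<Phi> x + (1 - \<omega>) * \<Phi> z + \<omega> * \<Phi> w"
    using \<omega> by (intro add_left_mono mult_left_mono \<Phi>_lower) auto
  finally show ?thesis by (simp add: C_def F_eq algebra_simps)
qed

end

subsection \<open>Expected progress of epochs and restart periods\<close>

abbreviation expectation :: "'s pmf \<Rightarrow> ('s \<Rightarrow> real) \<Rightarrow> real" where
  "expectation p f \<equiv> measure_pmf.expectation p f"

text \<open>Every draw is among finitely many indices, so all laws met here have finite support and
  integrability comes for free.\<close>

lemma expectation_mono:
  assumes "finite (set_pmf p)" "\<And>s. s \<in> set_pmf p \<Longrightarrow> f s \<le> g s"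
  shows "expectation p f \<le> expectation p g"
  using assms
  by (intro integral_mono_AE integrable_measure_pmf_finite) (auto simp: AE_measure_pmf_iff)

lemma expectation_affine:
  assumes "finite (set_pmf p)"
  shows "expectation p (\<lambda>s. a * f s + b) = a * expectation p f + b"
  using assms by (simp add: integrable_measure_pmf_finite)

lemma expectation_bind_le:
  assumes "finite (set_pmf p)" "\<And>s. s \<in> set_pmf p \<Longrightarrow> finite (set_pmf (K s))"
    and "\<And>s. s \<in> set_pmf p \<Longrightarrow> expectation (K s) f \<le> g s"
  shows "expectation (p \<bind> K) f \<le> expectation p g"
proof -
  have "expectation (p \<bind> K) f = (\<Sum>s\<in>set_pmf p. pmf p s *\<^sub>R expectation (K s) f)"
    by (rule pmf_expectation_bind) (use assms in auto)
  also have "\<dots> = expectation p (\<lambda>s. expectation (K s) f)"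
    by (rule integral_measure_pmf[symmetric]) (use assms in auto)
  also have "\<dots> \<le> expectation p g"
    by (rule expectation_mono) (use assms in auto)
  finally show ?thesis .
qed

lemma expectation_return: "expectation (return_pmf s) f = f s"
  by (simp add: integral_measure_pmf[of "{s}"])

text \<open>One induction serves inner steps, epochs and restart periods. \<open>I\<close> carries
  what holds surely, such as evaluation counts; \<open>V\<close> is the potential that decreases in
  expectation. The index starts at an arbitrary \<open>j\<close> because the iteration unfolds its
  first transition.\<close>

lemma iterate_pmf_supermartingale:
  fixes V :: "nat \<Rightarrow> 's \<Rightarrow> real"
  assumes finite: "\<And>s. finite (set_pmf (K s))"
    and invariant: "\<And>j s s'. I j s \<Longrightarrow> s' \<in> set_pmf (K s) \<Longrightarrow> I (Suc j) s'"
    and descent: "\<And>j s. I j s \<Longrightarrow> expectation (K s) (V (Suc j)) \<le> V j s"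
    and start: "I j s"
  shows "finite (set_pmf (iterate_pmf k K s)) \<and> (\<forall>s'\<in>set_pmf (iterate_pmf k K s). I (j + k) s')
      \<and> expectation (iterate_pmf k K s) (V (j + k)) \<le> V j s"
  using start
proof (induction k arbitrary: j s)
  case 0
  then show ?case by (simp add: expectation_return)
next
  case (Suc k)
  have IH: "finite (set_pmf (iterate_pmf k K t)) \<and> (\<forall>s'\<in>set_pmf (iterate_pmf k K t). I (j + Suc k) s')
      \<and> expectation (iterate_pmf k K t) (V (j + Suc k)) \<le> V (Suc j) t" if "t \<in> set_pmf (K s)" for t
    using Suc.IH[OF invariant[OF Suc.prems that]] by simp
  have "expectation (iterate_pmf (Suc k) K s) (V (j + Suc k)) \<le> expectation (K s) (V (Suc j))"
    unfolding iterate_pmf.simps by (rule expectation_bind_le) (use IH finite in auto)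
  also have "\<dots> \<le> V j s" by (rule descent[OF Suc.prems])
  finally show ?case using IH finite by auto
qed

text \<open>Jensen's inequality, scaled by the number of points so that the empty mean at
  \<open>j = 0\<close> (where \<open>1 / 0 = 0\<close>) contributes nothing.\<close>

lemma convex_on_running_mean:
  fixes f :: "'a::real_vector \<Rightarrow> real"
  assumes conv: "convex_on UNIV f" and "j = 0 \<Longrightarrow> X = 0"
  shows "real (Suc j) * f ((1 / real (Suc j)) *\<^sub>R (X + x)) \<le> real j * f ((1 / real j) *\<^sub>R X) + f x"
proof (cases "j = 0")
  case True
  then show ?thesis using assms by simp
next
  case False
  define t where "t = 1 / real (Suc j)"
  have t: "0 \<le> t" "t \<le> 1" "real (Suc j) * t = 1" "real (Suc j) * (1 - t) = real j"
    by (auto simp: t_def field_simps)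
  have "(1 - t) * (1 / real j) = t"
    using False by (simp add: t_def field_simps)
  then have eq: "t *\<^sub>R (X + x) = (1 - t) *\<^sub>R ((1 / real j) *\<^sub>R X) + t *\<^sub>R x"
    by (simp only: scaleR_add_right scaleR_scaleR)
  have "f (t *\<^sub>R (X + x)) \<le> (1 - t) * f ((1 / real j) *\<^sub>R X) + t * f x"
    unfolding eq by (rule convex_onD[OF conv]) (use t in auto)
  then have "real (Suc j) * f (t *\<^sub>R (X + x)) \<le> real (Suc j) * ((1 - t) * f ((1 / real j) *\<^sub>R X) + t * f x)"
    by (intro mult_left_mono) auto
  also have "\<dots> = (real (Suc j) * (1 - t)) * f ((1 / real j) *\<^sub>R X) + (real (Suc j) * t) * f x"
    by (simp only: distrib_left mult.assoc)
  finally show ?thesis unfolding t by (simp add: t_def)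
qed

section \<open>Inner loops, epochs and restart periods\<close>

context asvrg_problem
begin

text \<open>Separates the random index from the update, so that an expectation over one step becomes
  an \<open>average\<close>.\<close>

definition step_result :: "'a \<Rightarrow> 'a \<times> 'a \<times> 'a \<times> nat \<Rightarrow> nat \<Rightarrow> 'a \<times> 'a \<times> 'a \<times> nat" where
  "step_result z = (\<lambda>(x, y, X, c) i.
     let x' = z + \<omega> *\<^sub>R (prox z x y i - z) in (x', prox z x y i, X + x', c + 2))"

lemma asvrg_step_eq: "asvrg_step n \<phi> h \<eta> \<omega> z s = map_pmf (step_result z s) (pmf_of_set {..<n})"
  by (cases s) (simp add: asvrg_step_def step_result_def prox_def v_def map_pmf_def Let_def)

lemma lessThan_n: "{..<n} \<noteq> {}" "finite {..<n}"
  using n by (auto simp: lessThan_empty_iff)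

lemma expectation_asvrg_step:
  "expectation (asvrg_step n \<phi> h \<eta> \<omega> z s) V = average n (\<lambda>i. V (step_result z s i))"
  by (simp add: asvrg_step_eq integral_pmf_of_set[OF lessThan_n] average_def)

lemma set_asvrg_step: "set_pmf (asvrg_step n \<phi> h \<eta> \<omega> z s) = step_result z s ` {..<n}"
  by (simp add: asvrg_step_eq set_pmf_of_set[OF lessThan_n])

text \<open>The weight of the squared distance once the summed step inequalities are divided by
  \<open>m\<close>.\<close>

definition \<gamma> :: real where "\<gamma> = \<omega>\<^sup>2 / (2 * \<eta> * real m)"

text \<open>The potential \<open>V\<close> in the proof carries \<open>j\<close> times the value at the running mean of the first \<open>j\<close>
  iterates, because the state records only their sum, not the sum of their objective values.\<close>

lemma inner_loop:
  fixes w :: 'a and c :: nat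
  assumes x: "x = z + \<omega> *\<^sub>R (y - z)"
  defines "p \<equiv> iterate_pmf m (asvrg_step n \<phi> h \<eta> \<omega> z) (x, y, 0, c)"
  shows "finite (set_pmf p)"
    and "(x', y', X, c') \<in> set_pmf p \<Longrightarrow> c' = c + 2 * m"
    and "expectation p (\<lambda>(x', y', X, c'). F ((1 / real m) *\<^sub>R X) + \<gamma> * (norm (w - y'))\<^sup>2)
      \<le> (1 - \<omega>) * F z + \<omega> * F w + \<gamma> * (norm (w - y))\<^sup>2"
proof -
  define \<beta> C where "\<beta> = \<omega>\<^sup>2 / (2 * \<eta>)" and "C = (1 - \<omega>) * F z + \<omega> * F w"
  \<comment> \<open>The coupling of \<open>x\<close> with \<open>y\<close> and \<open>z\<close> must
    survive each step, since the one-step estimate relies on it.\<close>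
  define I where "I = (\<lambda>j (x, y, X, c'). x = z + \<omega> *\<^sub>R (y - z) \<and> (j = 0 \<longrightarrow> X = (0::'a)) \<and> c' = c + 2 * j)"
  define V where "V = (\<lambda>j (x::'a, y, X, c'::nat).
    real j * F ((1 / real j) *\<^sub>R X) + \<beta> * (norm (w - y))\<^sup>2 - real j * C)"
  have finite: "finite (set_pmf (asvrg_step n \<phi> h \<eta> \<omega> z s))" for s
    by (simp add: set_asvrg_step)
  have invariant: "I (Suc j) s'" if "I j s" "s' \<in> set_pmf (asvrg_step n \<phi> h \<eta> \<omega> z s)" for j s s'
    using that by (auto simp: I_def set_asvrg_step step_result_def Let_def)
  have descent: "expectation (asvrg_step n \<phi> h \<eta> \<omega> z s) (V (Suc j)) \<le> V j s" if "I j s" for j s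
  proof -
    obtain x y X c' where s: "s = (x, y, X, c')" by (cases s)
    have x: "x = z + \<omega> *\<^sub>R (y - z)" and X: "j = 0 \<Longrightarrow> X = 0" using that by (auto simp: I_def s)
    define P where "P i = prox z x y i" for i
    define K where "K = real j * F ((1 / real j) *\<^sub>R X) - real (Suc j) * C"
    have "expectation (asvrg_step n \<phi> h \<eta> \<omega> z s) (V (Suc j))
      = average n (\<lambda>i. real (Suc j) * F ((1 / real (Suc j)) *\<^sub>R (X + (z + \<omega> *\<^sub>R (P i - z))))
          + \<beta> * (norm (w - P i))\<^sup>2 - real (Suc j) * C)"
      by (simp add: expectation_asvrg_step V_def s step_result_def Let_def P_def)
    also have "\<dots> \<le> average n (\<lambda>i. (F (z + \<omega> *\<^sub>R (P i - z)) + \<beta> * (norm (w - P i))\<^sup>2) + K)"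
    proof (rule average_mono)
      fix i
      show "real (Suc j) * F ((1 / real (Suc j)) *\<^sub>R (X + (z + \<omega> *\<^sub>R (P i - z))))
          + \<beta> * (norm (w - P i))\<^sup>2 - real (Suc j) * C \<le> (F (z + \<omega> *\<^sub>R (P i - z)) + \<beta> * (norm (w - P i))\<^sup>2) + K"
      proof -
        have "real (Suc j) * F ((1 / real (Suc j)) *\<^sub>R (X + (z + \<omega> *\<^sub>R (P i - z))))
            \<le> real j * F ((1 / real j) *\<^sub>R X) + F (z + \<omega> *\<^sub>R (P i - z))"
          by (rule convex_on_running_mean[OF F_convex X])
        then show ?thesis unfolding K_def by linarith
      qed
    qed
    also have "\<dots> = average n (\<lambda>i. F (z + \<omega> *\<^sub>R (P i - z)) + \<beta> * (norm (w - P i))\<^sup>2) + K"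
      by (simp only: average_add average_const[OF n])
    also have "\<dots> \<le> C + \<beta> * (norm (w - y))\<^sup>2 + K"
      using expected_step_inequality[OF x, of w] by (simp add: C_def \<beta>_def P_def)
    finally show ?thesis by (simp add: V_def s K_def algebra_simps)
  qed
  have start: "I 0 (x, y, 0, c)" using x by (simp add: I_def)
  have super: "finite (set_pmf p) \<and> (\<forall>s'\<in>set_pmf p. I m s') \<and> expectation p (V m) \<le> V 0 (x, y, 0, c)"
    unfolding p_def
    by (rule iterate_pmf_supermartingale[where I = I and V = V and j = 0, unfolded add_0])
      (fact finite invariant descent start)+
  then show fin: "finite (set_pmf p)" by simp
  show "c' = c + 2 * m" if "(x', y', X, c') \<in> set_pmf p"
    using super that by (auto simp: I_def)
  define f where "f = (\<lambda>(x'::'a, y', X, c'::nat). F ((1 / real m) *\<^sub>R X) + \<gamma> * (norm (w - y'))\<^sup>2)"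
  have "\<beta> = real m * \<gamma>" using m \<eta> by (simp add: \<beta>_def \<gamma>_def)
  then have V: "V m = (\<lambda>s. real m * f s + (- real m * C))"
    by (auto simp: V_def f_def fun_eq_iff algebra_simps)
  have "real m * expectation p f + (- real m * C) \<le> \<beta> * (norm (w - y))\<^sup>2"
    using super unfolding V expectation_affine[OF fin] by (simp add: V_def)
  also have "\<dots> = real m * (\<gamma> * (norm (w - y))\<^sup>2)" by (simp add: \<open>\<beta> = real m * \<gamma>\<close>)
  finally have "real m * expectation p f \<le> real m * (C + \<gamma> * (norm (w - y))\<^sup>2)"
    by (simp add: algebra_simps)
  then have "expectation p f \<le> C + \<gamma> * (norm (w - y))\<^sup>2"
    using m by simp
  then show "expectation p (\<lambda>(x', y', X, c'). F ((1 / real m) *\<^sub>R X) + \<gamma> * (norm (w - y'))\<^sup>2)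
      \<le> (1 - \<omega>) * F z + \<omega> * F w + \<gamma> * (norm (w - y))\<^sup>2"
    by (simp add: f_def C_def)
qed

definition S :: nat where "S = restart_length \<eta> \<omega> m \<mu>"

lemma S_ge: "2 * ((1 - \<omega>) / \<omega> + \<omega> / (\<eta> * real m * \<mu>)) \<le> real S"
  unfolding S_def restart_length_def by (rule real_nat_ceiling_ge)

lemma S_pos: "0 < S"
proof -
  have "0 < 2 * ((1 - \<omega>) / \<omega> + \<omega> / (\<eta> * real m * \<mu>))"
    using \<omega> \<omega>_lt_1 \<eta> \<mu> m by (intro mult_pos_pos add_pos_pos divide_pos_pos) auto
  then show ?thesis using S_ge by linarith
qed

text \<open>In the inner-loop bound the new value \<open>F z'\<close> is split with weights
  \<open>\<omega>\<close> and \<open>1 - \<omega>\<close>: the second part telescopes against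
  \<open>(1 - \<omega>) * F z\<close>, the first accumulates, via Jensen, at the mean of the
  snapshots.\<close>

lemma expectation_epoch_le:
  fixes w :: 'a and c :: nat
  assumes x: "x = z + \<omega> *\<^sub>R (y - z)" and Z: "j = 0 \<Longrightarrow> Z = 0"
  defines "V \<equiv> (\<lambda>j (z, x::'a, y, Z, c::nat). \<omega> * (real j * F ((1 / real j) *\<^sub>R Z)) + (1 - \<omega>) * F z
       + \<gamma> * (norm (w - y))\<^sup>2 - \<omega> * real j * F w)"
  shows "finite (set_pmf (asvrg_epoch n \<phi> h \<eta> \<omega> m (z, x, y, Z, c)))"
    and "(z', x', y', Z', c') \<in> set_pmf (asvrg_epoch n \<phi> h \<eta> \<omega> m (z, x, y, Z, c)) \<Longrightarrow>
      x' = z' + \<omega> *\<^sub>R (y' - z') \<and> c' = c + (n + 2 * m)"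
    and "expectation (asvrg_epoch n \<phi> h \<eta> \<omega> m (z, x, y, Z, c)) (V (Suc j)) \<le> V j (z, x, y, Z, c)"
proof -
  define p where "p = iterate_pmf m (asvrg_step n \<phi> h \<eta> \<omega> z) (x, y, 0, c + n)"
  note inner = inner_loop[OF x, where c = "c + n", folded p_def]
  define out where "out = (\<lambda>(x'::'a, y', X, c'::nat).
     let z' = (1 / real m) *\<^sub>R X in (z', (1 - \<omega>) *\<^sub>R z' + \<omega> *\<^sub>R y', y', Z + z', c'))"
  have epoch: "asvrg_epoch n \<phi> h \<eta> \<omega> m (z, x, y, Z, c) = p \<bind> (\<lambda>s. return_pmf (out s))"
    by (auto simp: asvrg_epoch_def p_def out_def Let_def intro!: arg_cong2[of _ _ _ _ bind_pmf])
  show "finite (set_pmf (asvrg_epoch n \<phi> h \<eta> \<omega> m (z, x, y, Z, c)))"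
    using inner(1) by (simp add: epoch)
  show "x' = z' + \<omega> *\<^sub>R (y' - z') \<and> c' = c + (n + 2 * m)"
    if "(z', x', y', Z', c') \<in> set_pmf (asvrg_epoch n \<phi> h \<eta> \<omega> m (z, x, y, Z, c))"
  proof -
    from that obtain s where s: "s \<in> set_pmf p" "(z', x', y', Z', c') = out s"
      unfolding epoch by auto
    obtain x1 y1 X1 c1 where s': "s = (x1, y1, X1, c1)" by (cases s)
    show ?thesis
      using s(2) inner(2)[OF s(1)[unfolded s']]
      by (auto simp: s' out_def Let_def scaleR_diff_right scaleR_diff_left)
  qed
  define f where "f = (\<lambda>(x'::'a, y', X, c'::nat). F ((1 / real m) *\<^sub>R X) + \<gamma> * (norm (w - y'))\<^sup>2)"
  define K where "K = \<omega> * (real j * F ((1 / real j) *\<^sub>R Z)) - \<omega> * real (Suc j) * F w"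
  have "expectation (asvrg_epoch n \<phi> h \<eta> \<omega> m (z, x, y, Z, c)) (V (Suc j)) \<le> expectation p (\<lambda>s. 1 * f s + K)"
    unfolding epoch
  proof (rule expectation_bind_le[OF inner(1)])
    fix s assume "s \<in> set_pmf p"
    obtain x' y' X c' where s: "s = (x', y', X, c')" by (cases s)
    define z' where "z' = (1 / real m) *\<^sub>R X"
    have "\<omega> * (real (Suc j) * F ((1 / real (Suc j)) *\<^sub>R (Z + z')))
        \<le> \<omega> * (real j * F ((1 / real j) *\<^sub>R Z) + F z')"
      by (intro mult_left_mono convex_on_running_mean[OF F_convex] Z) (use \<omega> in auto)
    then show "expectation (return_pmf (out s)) (V (Suc j)) \<le> 1 * f s + K"
      unfolding expectation_return s f_def K_def V_def out_def Let_def prod.case z'_def[symmetric]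
      by (simp add: algebra_simps)
  qed simp
  also have "\<dots> = expectation p f + K" using expectation_affine[OF inner(1), of 1 f K] by simp
  also have "\<dots> \<le> (1 - \<omega>) * F z + \<omega> * F w + \<gamma> * (norm (w - y))\<^sup>2 + K"
    using inner(3)[of w] by (simp add: f_def)
  also have "\<dots> = V j (z, x, y, Z, c)"
    by (simp add: V_def K_def algebra_simps)
  finally show "expectation (asvrg_epoch n \<phi> h \<eta> \<omega> m (z, x, y, Z, c)) (V (Suc j)) \<le> V j (z, x, y, Z, c)" .
qed

text \<open>Over a whole period the potential bounds \<open>\<omega> * real S\<close> times the
  final gap by the initial gap and the squared distance to \<open>w\<close>. Quadratic growth at
  \<open>w\<close> removes the distance, and \<open>S\<close> is long enough to leave the factor one
  half.\<close>

lemma asvrg_period_halves_gap: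
  fixes z0 :: 'a and c :: nat
  assumes w: "\<And>y. F w \<le> F y"
  defines "p \<equiv> asvrg_period n \<phi> h \<mu> \<eta> \<omega> m (z0, c)"
  shows "finite (set_pmf p)"
    and "(z', c') \<in> set_pmf p \<Longrightarrow> c' = c + S * (n + 2 * m)"
    and "expectation p (\<lambda>(z', c'). F z' - F w) \<le> (F z0 - F w) / 2"
proof -
  define I where "I = (\<lambda>j (z::'a, x, y, Z, c').
    x = z + \<omega> *\<^sub>R (y - z) \<and> (j = 0 \<longrightarrow> Z = (0::'a)) \<and> c' = c + j * (n + 2 * m))"
  define V where "V = (\<lambda>j (z, x::'a, y, Z, c::nat). \<omega> * (real j * F ((1 / real j) *\<^sub>R Z)) + (1 - \<omega>) * F z
       + \<gamma> * (norm (w - y))\<^sup>2 - \<omega> * real j * F w)"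
  let ?K = "asvrg_epoch n \<phi> h \<eta> \<omega> m"
  have "0 < \<gamma>" using \<omega> \<eta> m by (simp add: \<gamma>_def)
  have finite: "finite (set_pmf (?K s))" for s
  proof -
    have "finite (set_pmf (asvrg_step n \<phi> h \<eta> \<omega> z s))" for z s
      by (simp add: set_asvrg_step)
    then have "finite (set_pmf (iterate_pmf k (asvrg_step n \<phi> h \<eta> \<omega> z) s))" for k z s
      by (induction k arbitrary: s) auto
    then show ?thesis by (cases s) (auto simp: asvrg_epoch_def Let_def)
  qed
  have invariant: "I (Suc j) s'" if "I j s" "s' \<in> set_pmf (?K s)" for j s s'
  proof -
    obtain z x y Z c1 where s: "s = (z, x, y, Z, c1)" by (cases s)
    obtain z' x' y' Z' c1' where s': "s' = (z', x', y', Z', c1')" by (cases s')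
    show ?thesis
      using that expectation_epoch_le(2)[of x z y j Z z' x' y' Z' c1' c1]
      by (auto simp: I_def s s')
  qed
  have descent: "expectation (?K s) (V (Suc j)) \<le> V j s" if "I j s" for j s
  proof -
    obtain z x y Z c1 where s: "s = (z, x, y, Z, c1)" by (cases s)
    show ?thesis unfolding s V_def
      by (rule expectation_epoch_le(3)) (use that in \<open>auto simp: I_def s\<close>)
  qed
  have start: "I 0 (z0, z0, z0, 0, c)" by (simp add: I_def)
  define q where "q = iterate_pmf S ?K (z0, z0, z0, 0, c)"
  have super: "finite (set_pmf q) \<and> (\<forall>s'\<in>set_pmf q. I S s') \<and> expectation q (V S) \<le> V 0 (z0, z0, z0, 0, c)"
    unfolding q_def
    by (rule iterate_pmf_supermartingale[where I = I and V = V and j = 0, unfolded add_0])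
      (fact finite invariant descent start)+
  define out where "out = (\<lambda>(z::'a, x::'a, y::'a, Z::'a, c'::nat). ((1 / real S) *\<^sub>R Z, c'))"
  have p: "p = q \<bind> (\<lambda>s. return_pmf (out s))"
    by (auto simp: p_def asvrg_period_def q_def out_def Let_def S_def intro!: arg_cong2[of _ _ _ _ bind_pmf])
  have q: "finite (set_pmf q)" using super by simp
  then show "finite (set_pmf p)" by (simp add: p)
  show "c' = c + S * (n + 2 * m)" if "(z', c') \<in> set_pmf p"
  proof -
    from that obtain s where s: "s \<in> set_pmf q" "(z', c') = out s"
      unfolding p by auto
    obtain z1 x1 y1 Z1 c1 where s': "s = (z1, x1, y1, Z1, c1)" by (cases s)
    show ?thesis
      using s super by (auto simp: s' out_def I_def)
  qed
  have "\<omega> * real S * expectation p (\<lambda>(z', c'). F z' - F w) + (1 - \<omega>) * F w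
      = expectation p (\<lambda>s. \<omega> * real S * (case s of (z', c') \<Rightarrow> F z' - F w) + (1 - \<omega>) * F w)"
    by (rule expectation_affine[symmetric]) (use \<open>finite (set_pmf p)\<close> in auto)
  also have "\<dots> \<le> expectation q (V S)"
    unfolding p
  proof (rule expectation_bind_le[OF q])
    fix s assume "s \<in> set_pmf q"
    obtain z x y Z c1 where s: "s = (z, x, y, Z, c1)" by (cases s)
    \<comment> \<open>The last snapshot is only known to be no better than \<open>w\<close>; this
      explains the extra summand \<open>(1 - \<omega>) * F w\<close> in the chain.\<close>
    have "(1 - \<omega>) * F w \<le> (1 - \<omega>) * F z" by (intro mult_left_mono w) (use \<omega>_lt_1 in auto)
    moreover have "0 \<le> \<gamma> * (norm (w - y))\<^sup>2" using \<open>0 < \<gamma>\<close> by simp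
    ultimately show "expectation (return_pmf (out s))
        (\<lambda>s. \<omega> * real S * (case s of (z', c') \<Rightarrow> F z' - F w) + (1 - \<omega>) * F w) \<le> V S s"
      by (simp add: expectation_return s out_def V_def algebra_simps)
  qed simp
  also have "\<dots> \<le> V 0 (z0, z0, z0, 0, c)" using super by simp
  also have "\<dots> = (1 - \<omega>) * F z0 + \<gamma> * (norm (w - z0))\<^sup>2" by (simp add: V_def)
  also have "\<dots> \<le> (1 - \<omega>) * F z0 + \<gamma> * (2 / \<mu> * (F z0 - F w))"
  proof (intro add_left_mono mult_left_mono)
    show "(norm (w - z0))\<^sup>2 \<le> 2 / \<mu> * (F z0 - F w)"
      using F_minimizer_growth[OF w, of z0] \<mu> by (simp add: field_simps)
  qed (use \<open>0 < \<gamma>\<close> in simp)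
  finally have "\<omega> * real S * expectation p (\<lambda>(z', c'). F z' - F w)
      \<le> (1 - \<omega> + 2 * \<gamma> / \<mu>) * (F z0 - F w)"
    by (simp add: algebra_simps)
  \<comment> \<open>The coefficient is \<open>\<omega> / 2\<close> times the restart length before
    rounding.\<close>
  also have "1 - \<omega> + 2 * \<gamma> / \<mu> = \<omega> / 2 * (2 * ((1 - \<omega>) / \<omega> + \<omega> / (\<eta> * real m * \<mu>)))"
    using \<omega> \<eta> \<mu> m by (simp add: \<gamma>_def field_simps power2_eq_square)
  also have "\<dots> * (F z0 - F w) \<le> \<omega> / 2 * real S * (F z0 - F w)"
    by (intro mult_right_mono mult_left_mono S_ge) (use \<omega> w[of z0] in auto)
  also have "\<dots> = \<omega> * real S * ((F z0 - F w) / 2)" by simp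
  finally show "expectation p (\<lambda>(z', c'). F z' - F w) \<le> (F z0 - F w) / 2"
    using \<omega> S_pos by simp
qed

text \<open>The start is a law rather than a point because a later round begins at a random output;
  the bound is shown for each starting state and averaged over \<open>p\<close>.\<close>

lemma asvrg_halves_gap:
  assumes fin: "finite (set_pmf p)"
  defines "q k \<equiv> asvrg n \<phi> h \<mu> \<eta> \<omega> m k p"
  shows "finite (set_pmf (q k))"
    and "(z', c') \<in> set_pmf (q k) \<Longrightarrow> \<exists>z c. (z, c) \<in> set_pmf p \<and> c' = c + k * (S * (n + 2 * m))"
    and "expected_gap F (q k) \<le> expected_gap F p / 2 ^ k"
proof -
  obtain w where w: "\<And>y. F w \<le> F y" using F_attains_inf by blast
  let ?K = "asvrg_period n \<phi> h \<mu> \<eta> \<omega> m"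
  \<comment> \<open>The factor \<open>2 ^ j\<close> turns halving into monotone decrease.\<close>
  define V where "V = (\<lambda>j (z, c::nat). 2 ^ j * (F z - F w))"
  define I where "I = (\<lambda>c0 j (z::'a, c). c = c0 + j * (S * (n + 2 * m)))"
  have finite: "finite (set_pmf (?K s))" for s
    using asvrg_period_halves_gap(1)[OF w] by (cases s) simp
  have invariant: "I c0 (Suc j) s'" if "I c0 j s" "s' \<in> set_pmf (?K s)" for c0 j s s'
    using asvrg_period_halves_gap(2)[OF w] that by (cases s; cases s') (force simp: I_def)
  have descent: "expectation (?K s) (V (Suc j)) \<le> V j s" if "I c0 j s" for c0 j s
  proof -
    obtain z c where s: "s = (z, c)" by (cases s)
    have "expectation (?K s) (V (Suc j)) = 2 ^ Suc j * expectation (?K s) (\<lambda>(z', c'). F z' - F w)"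
      using expectation_affine[OF finite, where a = "2 ^ Suc j" and b = 0 and f = "\<lambda>(z', c'). F z' - F w"]
      by (simp add: V_def case_prod_unfold)
    also have "\<dots> \<le> 2 ^ Suc j * ((F z - F w) / 2)"
      unfolding s by (intro mult_left_mono asvrg_period_halves_gap[OF w]) auto
    finally show ?thesis by (simp add: V_def s)
  qed
  have start: "I c 0 (z, c)" for z c by (simp add: I_def)
  have super: "finite (set_pmf (iterate_pmf k ?K (z, c))) \<and> (\<forall>s'\<in>set_pmf (iterate_pmf k ?K (z, c)). I c k s')
      \<and> expectation (iterate_pmf k ?K (z, c)) (V k) \<le> V 0 (z, c)" for z c
    by (rule iterate_pmf_supermartingale[where I = "I c" and V = V and j = 0, unfolded add_0])
      (fact finite invariant descent start)+
  have periods: "finite (set_pmf (iterate_pmf k ?K (z, c)))"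
    "s' \<in> set_pmf (iterate_pmf k ?K (z, c)) \<Longrightarrow> snd s' = c + k * (S * (n + 2 * m))"
    "expectation (iterate_pmf k ?K (z, c)) (V k) \<le> F z - F w" for z c s'
    using super[of z c] by (auto simp: I_def V_def case_prod_unfold)
  show fq: "finite (set_pmf (q k))"
    using fin periods(1) by (auto simp: q_def asvrg_def)
  show "\<exists>z c. (z, c) \<in> set_pmf p \<and> c' = c + k * (S * (n + 2 * m))" if "(z', c') \<in> set_pmf (q k)"
  proof -
    from that obtain z c where "(z, c) \<in> set_pmf p" "(z', c') \<in> set_pmf (iterate_pmf k ?K (z, c))"
      by (auto simp: q_def asvrg_def)
    then show ?thesis using periods(2) by fastforce
  qed
  have gap: "expected_gap F r = expectation r (\<lambda>(z, c). F z - F w)" if "finite (set_pmf r)" for r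
  proof -
    have "(INF y. F y) = F w" by (rule cInf_eq_minimum) (use w in auto)
    then show ?thesis
      using expectation_affine[OF that, of 1 "\<lambda>(z, c). F z" "- F w"]
      by (simp add: expected_gap_def expected_value_def case_prod_unfold)
  qed
  have "2 ^ k * expectation (q k) (\<lambda>(z, c). F z - F w) = expectation (q k) (V k)"
    using expectation_affine[OF fq, of "2 ^ k" "\<lambda>(z, c). F z - F w" 0]
    by (simp add: V_def case_prod_unfold)
  also have "\<dots> \<le> expectation p (\<lambda>(z, c). F z - F w)"
    unfolding q_def asvrg_def
  proof (rule expectation_bind_le[OF fin])
    fix s :: "'a \<times> nat"
    obtain z c where s: "s = (z, c)" by (cases s)
    show "finite (set_pmf (iterate_pmf k ?K s))"
      unfolding s by (rule periods)
    show "expectation (iterate_pmf k ?K s) (V k) \<le> (case s of (z, c) \<Rightarrow> F z - F w)"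
      using periods(3) by (simp add: s)
  qed
  finally show "expected_gap F (q k) \<le> expected_gap F p / 2 ^ k"
    using fin fq by (simp add: gap field_simps)
qed

end

subsection \<open>Adaptive smoothing\<close>

context asvrg_problem
begin

lemma expected_gap_eq:
  assumes "\<And>y. F w \<le> F y"
  shows "expected_gap F r = expected_value F r - F w"
proof -
  have "(INF y. F y) = F w" by (rule cInf_eq_minimum) (use assms in auto)
  then show ?thesis by (simp add: expected_gap_def)
qed

text \<open>Two halvings reach a quarter, so the first successful number of periods, which the
  stopping rule demands, is at most 2.\<close>

lemma asvrg_round:
  assumes fin: "finite (set_pmf p)"
  defines "run \<equiv> \<lambda>j. asvrg n \<phi> h \<mu> \<eta> \<omega> m j p"
  obtains k where "k \<le> 2"
    and "expected_gap F (run k) \<le> 1 / 4 * expected_gap F p"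
    and "\<forall>j<k. \<not> expected_gap F (run j) \<le> 1 / 4 * expected_gap F p"
proof -
  define P where "P j \<longleftrightarrow> expected_gap F (run j) \<le> 1 / 4 * expected_gap F p" for j
  have "P 2" using asvrg_halves_gap(3)[OF fin, of 2] by (simp add: P_def run_def)
  then have "(LEAST j. P j) \<le> 2" "P (LEAST j. P j)" "\<forall>j<(LEAST j. P j). \<not> P j"
    by (auto intro: Least_le LeastI dest: not_less_Least)
  then show ?thesis unfolding P_def by (rule that)
qed

end

section \<open>Smoothed objectives across rounds\<close>

lemma objective_mono:
  assumes "\<And>i. i < n \<Longrightarrow> \<phi> i x \<le> \<psi> i x"
  shows "objective n \<phi> h x \<le> objective n \<psi> h x"
  by (simp add: objective_eq_average average_mono assms)

lemma objective_le_plus: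
  assumes "1 \<le> n" "\<And>i. i < n \<Longrightarrow> \<phi> i x \<le> \<psi> i x + e"
  shows "objective n \<phi> h x \<le> objective n \<psi> h x + e"
proof -
  have "average n (\<lambda>i. \<phi> i x) \<le> average n (\<lambda>i. \<psi> i x + e)"
    by (rule average_mono) (rule assms)
  then show ?thesis by (simp add: objective_eq_average average_add average_const[OF assms(1)])
qed

lemma expected_value_mono:
  assumes "finite (set_pmf p)" "\<And>x. P x \<le> Q x"
  shows "expected_value P p \<le> expected_value Q p"
  unfolding expected_value_def by (rule expectation_mono) (use assms in auto)

lemma expected_value_plus_const:
  assumes "finite (set_pmf p)"
  shows "expected_value (\<lambda>x. P x + e) p = expected_value P p + e"
  using expectation_affine[OF assms, of 1 "\<lambda>(x, c). P x" e]
  by (simp add: expected_value_def case_prod_unfold)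

text \<open>The induction compares the true \<open>F\<close> of the output with the smoothed
  objective of the coming round at every \<open>y\<close>; this serves for the minimizer of that
  round and finally for the minimizer of \<open>F\<close>. The count assumes two periods per
  round.\<close>

lemma adaptive_smoothing_rounds:
  fixes f :: "nat \<Rightarrow> 'a::euclidean_space \<Rightarrow> real" and g :: "'a \<Rightarrow> real"
  assumes n: "1 \<le> n" and "0 < \<mu>" and "0 < \<delta>0"
    and f: "\<And>i. i < n \<Longrightarrow> convex_on UNIV (f i) \<and> G-lipschitz_on UNIV (f i)"
    and g: "strongly_convex \<mu> g"
    and parameters: "\<And>t. t < T \<Longrightarrow> asvrg_parameters (\<delta>0 * 2 ^ t) (\<eta> t) (\<omega> t) (m t)"
    and gap: "\<And>y. objective n f g x0 - objective n f g y \<le> \<Delta>"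
    and \<delta>0: "G\<^sup>2 / (2 * \<delta>0) \<le> \<Delta>"
    and "t \<le> T"
  defines "F \<equiv> objective n f g"
    and "F' \<equiv> \<lambda>t. objective n (\<lambda>i. moreau_envelope (\<delta>0 * 2 ^ t) (f i)) g"
  shows "\<exists>p. adaptive_smoothing n f g \<mu> \<delta>0 \<eta> \<omega> m x0 t p \<and> finite (set_pmf p)
    \<and> (\<forall>y. expected_value F p - F' t y \<le> 4 * \<Delta> / 2 ^ t)
    \<and> (\<forall>(x, c)\<in>set_pmf p. c \<le> (\<Sum>s<t. 2 * (restart_length (\<eta> s) (\<omega> s) (m s) \<mu> * (n + 2 * m s))))"
  using \<open>t \<le> T\<close>
proof (induction t)
  have F'_le: "F' t x \<le> F x" for t x
    unfolding F_def F'_def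
    by (intro objective_mono moreau_envelope_le) (use f \<open>0 < \<delta>0\<close> in auto)
  have F'_mono: "F' t x \<le> F' (Suc t) x" for t x
    unfolding F'_def by (intro objective_mono moreau_envelope_mono) (use f \<open>0 < \<delta>0\<close> in auto)
  have F_le: "F x \<le> F' t x + \<Delta> / 2 ^ t" for t x
  proof -
    have "F x \<le> F' t x + G\<^sup>2 / (2 * (\<delta>0 * 2 ^ t))"
      unfolding F_def F'_def
      by (intro objective_le_plus n le_moreau_envelope_plus) (use f \<open>0 < \<delta>0\<close> in auto)
    also have "G\<^sup>2 / (2 * (\<delta>0 * 2 ^ t)) = G\<^sup>2 / (2 * \<delta>0) / 2 ^ t" by simp
    also have "\<dots> \<le> \<Delta> / 2 ^ t" by (intro divide_right_mono \<delta>0) simp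
    finally show ?thesis by simp
  qed
  {
    case 0
    have "0 \<le> \<Delta>" using gap[of x0] by simp
    \<comment> \<open>The initial gap and the initial smoothing error are each at most
      \<open>\<Delta>\<close>.\<close>
    then have "F x0 - F' 0 y \<le> 4 * \<Delta>" for y
      using gap[of y] F_le[of y 0] by (simp add: F_def)
    then show ?case
      by (intro exI[of _ "return_pmf (x0, 0)"] conjI adaptive_smoothing.start)
        (auto simp: expected_value_def expectation_return)
  next
    case (Suc t)
    then obtain p where p: "adaptive_smoothing n f g \<mu> \<delta>0 \<eta> \<omega> m x0 t p" "finite (set_pmf p)"
      "\<And>y. expected_value F p - F' t y \<le> 4 * \<Delta> / 2 ^ t"
      "\<And>x c. (x, c) \<in> set_pmf p \<Longrightarrow> c \<le> (\<Sum>s<t. 2 * (restart_length (\<eta> s) (\<omega> s) (m s) \<mu> * (n + 2 * m s)))"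
      by fastforce
    define \<phi> where "\<phi> = (\<lambda>i. moreau_envelope (\<delta>0 * 2 ^ t) (f i))"
    interpret asvrg_problem n "m t" \<phi> g "\<delta>0 * 2 ^ t" \<mu> "\<eta> t" "\<omega> t"
      using n \<open>0 < \<mu>\<close> \<open>0 < \<delta>0\<close> g parameters[of t] Suc.prems f
      by unfold_locales (auto simp: \<phi>_def intro!: convex_smooth_moreau_envelope)
    have obj: "objective n \<phi> g = F' t" by (simp add: F'_def \<phi>_def)
    obtain w where w: "\<And>y. F' t w \<le> F' t y" using F_attains_inf unfolding obj by blast
    define run where "run = (\<lambda>j. asvrg n \<phi> g \<mu> (\<eta> t) (\<omega> t) (m t) j p)"
    obtain k where k: "k \<le> 2" "expected_gap (F' t) (run k) \<le> 1 / 4 * expected_gap (F' t) p"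
      "\<forall>j<k. \<not> expected_gap (F' t) (run j) \<le> 1 / 4 * expected_gap (F' t) p"
      using asvrg_round[OF p(2)] unfolding obj run_def by blast
    have "adaptive_smoothing n f g \<mu> \<delta>0 \<eta> \<omega> m x0 (Suc t) (run k)"
      by (rule adaptive_smoothing.round[OF p(1) \<phi>_def run_def]) (use k obj in auto)
    moreover have fin: "finite (set_pmf (run k))"
      unfolding run_def by (rule asvrg_halves_gap[OF p(2)])
    moreover have "expected_value F (run k) - F' (Suc t) y \<le> 4 * \<Delta> / 2 ^ Suc t" for y
    proof -
      have gap_eq: "expected_gap (F' t) r = expected_value (F' t) r - F' t w" for r
        using expected_gap_eq[unfolded obj, OF w] .
      have "expected_value (F' t) p \<le> expected_value F p"
        by (intro expected_value_mono p F'_le)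
      then have "expected_gap (F' t) p \<le> 4 * \<Delta> / 2 ^ t"
        using p(3)[of w] by (simp add: gap_eq)
      then have "expected_value (F' t) (run k) - F' t w \<le> \<Delta> / 2 ^ t"
        using k(2) by (simp add: gap_eq)
      moreover have "expected_value F (run k) \<le> expected_value (F' t) (run k) + \<Delta> / 2 ^ t"
        using expected_value_mono[OF fin, of F "\<lambda>x. F' t x + \<Delta> / 2 ^ t", OF F_le]
        by (simp add: expected_value_plus_const[OF fin])
      \<comment> \<open>A quarter of \<open>4 * \<Delta> / 2 ^ t\<close> plus the smoothing error
        \<open>\<Delta> / 2 ^ t\<close> is again \<open>4 * \<Delta> / 2 ^ Suc t\<close>, which is
        why the constant is 4. Monotonicity in the smoothing parameter passes to the next
        objective.\<close>
      ultimately have "expected_value F (run k) - F' (Suc t) y \<le> \<Delta> / 2 ^ t + \<Delta> / 2 ^ t"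
        using w[of y] F'_mono[of t y] by linarith
      then show ?thesis by simp
    qed
    moreover have "c' \<le> (\<Sum>s<Suc t. 2 * (restart_length (\<eta> s) (\<omega> s) (m s) \<mu> * (n + 2 * m s)))"
      if "(x', c') \<in> set_pmf (run k)" for x' c'
    proof -
      obtain x c where c: "(x, c) \<in> set_pmf p" "c' = c + k * (S * (n + 2 * m t))"
        using asvrg_halves_gap(2)[OF p(2)] \<open>(x', c') \<in> set_pmf (run k)\<close> unfolding run_def by blast
      have "k * (S * (n + 2 * m t)) \<le> 2 * (S * (n + 2 * m t))"
        by (rule mult_right_mono) (use k in auto)
      then have "c' \<le> (\<Sum>s<t. 2 * (restart_length (\<eta> s) (\<omega> s) (m s) \<mu> * (n + 2 * m s))) + 2 * (S * (n + 2 * m t))"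
        using p(4)[OF c(1)] c(2) by linarith
      then show ?thesis by (simp add: S_def)
    qed
    ultimately show ?case by blast
  }
qed

section \<open>Parameter choice and total cost\<close>

text \<open>Here \<open>q\<close> stands for \<open>max 1 (sqrt (L / (n * \<mu>)))\<close>: with the momentum \<open>1 / (2 * q)\<close> the two terms of
  the restart length are of the same order.\<close>

lemma restart_length_le:
  fixes L \<mu> q :: real
  assumes n: "1 \<le> n" and "0 < L" "0 < \<mu>" "1 \<le> q" and q: "L / (real n * \<mu>) \<le> q\<^sup>2"
  shows "real (restart_length (1 / (4 * L)) (1 / (2 * q)) n \<mu>) \<le> 8 * q"
proof -
  define r u where "r = L / (real n * \<mu>)" and "u = r / q"
  have "0 < r" using assms by (simp add: r_def)
  have "u \<le> q" using q \<open>1 \<le> q\<close> by (simp add: u_def r_def[symmetric] divide_le_eq power2_eq_square)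
  have "(1 / (2 * q)) / (1 / (4 * L) * real n * \<mu>) = 2 * u"
    using assms by (simp add: u_def r_def field_simps)
  moreover have "(1 - 1 / (2 * q)) / (1 / (2 * q)) = 2 * q - 1"
    using \<open>1 \<le> q\<close> by (simp add: field_simps)
  ultimately have S: "restart_length (1 / (4 * L)) (1 / (2 * q)) n \<mu> = nat \<lceil>2 * (2 * q - 1 + 2 * u)\<rceil>"
    by (simp add: restart_length_def)
  have "0 \<le> u" using \<open>0 < r\<close> \<open>1 \<le> q\<close> by (simp add: u_def)
  then have "0 \<le> 2 * (2 * q - 1 + 2 * u)" using \<open>1 \<le> q\<close> by simp
  then have "real (nat \<lceil>2 * (2 * q - 1 + 2 * u)\<rceil>) \<le> 2 * (2 * q - 1 + 2 * u) + 1"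
    by linarith
  \<comment> \<open>The 1 lost by rounding up is absorbed by the -2 inside the doubled
    expression.\<close>
  also have "\<dots> \<le> 8 * q" using \<open>u \<le> q\<close> by (simp add: algebra_simps)
  finally show ?thesis unfolding S .
qed

text \<open>With \<open>L * \<eta> = 1 / 4\<close> the admissible momentum reaches
  \<open>2 / 3\<close>, while \<open>1 / (2 * q)\<close> is at most \<open>1 / 2\<close>.\<close>

lemma asvrg_parameters_choice:
  assumes "1 \<le> n" "0 < L" "1 \<le> (q::real)"
  shows "asvrg_parameters L (1 / (4 * L)) (1 / (2 * q)) n"
proof -
  have "1 / (2 * q) \<le> 2 / 3" "0 < 1 / (2 * q)" using assms by (simp_all add: field_simps)
  moreover have "1 - L * (1 / (4 * L)) / (1 - L * (1 / (4 * L))) = 2 / 3" using assms by simp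
  moreover have "1 / (4 * L) < 1 / L" using assms by (intro divide_strict_left_mono) auto
  ultimately show ?thesis using assms by (simp only: asvrg_parameters_def) simp
qed

text \<open>A geometric sum with ratio \<open>sqrt 2\<close>; the constant 3 carries the induction
  because \<open>4 \<le> 3 * sqrt 2\<close>.\<close>

lemma sum_sqrt_two_powers_le: "(\<Sum>t<T. sqrt (2 ^ t)) \<le> 3 * sqrt (2 ^ T)"
proof (induction T)
  case (Suc T)
  have "4 / 3 \<le> sqrt 2" by (rule real_le_rsqrt) (simp add: power2_eq_square)
  then have "4 * sqrt (2 ^ T) \<le> 3 * (sqrt 2 * sqrt (2 ^ T))"
    using mult_right_mono[of "4 / 3" "sqrt 2" "sqrt (2 ^ T)"] by simp
  then show ?case
    using Suc unfolding sum.lessThan_Suc power_Suc real_sqrt_mult by linarith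
qed simp

lemma two_power_ceiling_log:
  assumes "1 \<le> x"
  defines "T \<equiv> nat \<lceil>log 2 x\<rceil>"
  shows "x \<le> 2 ^ T" and "2 ^ T \<le> 2 * x" and "real T \<le> log 2 x + 1"
proof -
  have "0 \<le> log 2 x" using assms by simp
  then have T: "log 2 x \<le> real T" "real T \<le> log 2 x + 1" unfolding T_def by linarith+
  have pow: "2 powr real T = 2 ^ T" by (simp add: powr_realpow)
  have "x = 2 powr log 2 x" using assms by simp
  also have "\<dots> \<le> 2 ^ T" unfolding pow[symmetric] using T by (intro powr_mono) auto
  finally show "x \<le> 2 ^ T" .
  have "2 ^ T \<le> 2 powr (log 2 x + 1)" unfolding pow[symmetric] using T by (intro powr_mono) auto
  also have "\<dots> = 2 * x" using assms by (simp add: powr_add)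
  finally show "2 ^ T \<le> 2 * x" .
  show "real T \<le> log 2 x + 1" by (rule T)
qed

definition momentum_scale :: "real \<Rightarrow> nat \<Rightarrow> real \<Rightarrow> real" where
  "momentum_scale L n \<mu> = max 1 (sqrt (L / (real n * \<mu>)))"

lemma momentum_scale_ge:
  assumes "0 < L" "1 \<le> n" "0 < \<mu>"
  shows "1 \<le> momentum_scale L n \<mu>" "L / (real n * \<mu>) \<le> (momentum_scale L n \<mu>)\<^sup>2"
proof -
  show ge: "1 \<le> momentum_scale L n \<mu>" by (simp add: momentum_scale_def)
  have "sqrt (L / (real n * \<mu>)) \<le> momentum_scale L n \<mu>" by (simp add: momentum_scale_def)
  then show "L / (real n * \<mu>) \<le> (momentum_scale L n \<mu>)\<^sup>2"
    using ge by (intro sqrt_le_D) auto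
qed

text \<open>For nonzero \<open>G\<close> the maximum in \<open>momentum_scale\<close> is bounded by
  a sum: the ones give \<open>n\<close> per round, hence the logarithm, and the square roots form
  the geometric sum. For \<open>G = 0\<close> only the ones remain.\<close>

lemma total_evaluations_le:
  fixes \<Delta> \<epsilon> G \<mu> :: real
  assumes "0 < \<epsilon>" "2 * \<epsilon> \<le> \<Delta>" "0 \<le> G" "1 \<le> n" "0 < \<mu>"
  defines "T \<equiv> nat \<lceil>log 2 (4 * \<Delta> / \<epsilon>)\<rceil>"
  defines "\<delta>0 \<equiv> (if G = 0 then real n * \<mu> / 2 ^ T else G\<^sup>2 / (2 * \<Delta>))"
  shows "(\<Sum>t<T. 48 * real n * momentum_scale (\<delta>0 * 2 ^ t) n \<mu>)
    \<le> 1000 * (real n * ln (\<Delta> / \<epsilon>) + sqrt (real n) * G / sqrt (\<mu> * \<epsilon>))"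
proof -
  have "0 < \<Delta>" using assms by linarith
  have "2 \<le> \<Delta> / \<epsilon>" using assms by (simp add: field_simps)
  then have "1 \<le> 4 * \<Delta> / \<epsilon>" by simp
  note T = two_power_ceiling_log[OF this, folded T_def]
  have "1 \<le> log 2 (\<Delta> / \<epsilon>)" using \<open>2 \<le> \<Delta> / \<epsilon>\<close> by (simp add: le_log_iff)
  have "log 2 (4 * \<Delta> / \<epsilon>) = log 2 ((\<Delta> / \<epsilon>) * 2 powr 2)" by (simp add: mult.commute)
  also have "\<dots> = log 2 (\<Delta> / \<epsilon>) + 2"
    using \<open>2 \<le> \<Delta> / \<epsilon>\<close> by (intro log_add_eq_powr[symmetric]) auto
  \<comment> \<open>\<open>T\<close> exceeds \<open>log 2 (\<Delta> / \<epsilon>)\<close> by at most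
    3, and that logarithm is at least 1 because
    \<open>2 * \<epsilon> \<le> \<Delta>\<close>.\<close>
  finally have "real T \<le> 4 * log 2 (\<Delta> / \<epsilon>)" using T(3) \<open>1 \<le> log 2 (\<Delta> / \<epsilon>)\<close> by linarith
  also have "\<dots> \<le> 8 * ln (\<Delta> / \<epsilon>)"
  proof -
    have "0 \<le> ln (\<Delta> / \<epsilon>)" using \<open>2 \<le> \<Delta> / \<epsilon>\<close> by simp
    then have "ln (\<Delta> / \<epsilon>) * 1 \<le> ln (\<Delta> / \<epsilon>) * (2 * ln 2)"
      using ln2_ge_two_thirds by (intro mult_left_mono) auto
    then show ?thesis by (simp add: log_def pos_divide_le_eq mult_ac)
  qed
  finally have T_le: "real T \<le> 8 * ln (\<Delta> / \<epsilon>)" .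
  define R where "R = sqrt (real n) * G / sqrt (\<mu> * \<epsilon>)"
  have "0 \<le> R" using assms by (simp add: R_def)
  have "(\<Sum>t<T. real n * momentum_scale (\<delta>0 * 2 ^ t) n \<mu>) \<le> real n * real T + 6 * R"
  proof (cases "G = 0")
    case True
    have "momentum_scale (\<delta>0 * 2 ^ t) n \<mu> = 1" if "t < T" for t
    proof -
      have "\<delta>0 * 2 ^ t / (real n * \<mu>) = 2 ^ t / 2 ^ T"
        using True assms(4,5) by (simp add: \<delta>0_def)
      also have "\<dots> \<le> 1" using that by simp
      finally show ?thesis by (simp add: momentum_scale_def)
    qed
    then show ?thesis using \<open>0 \<le> R\<close> by simp
  next
    case False
    then have "0 < G" using assms by simp
    have "0 < real n" using assms by simp
    have "real n * momentum_scale (\<delta>0 * 2 ^ t) n \<mu> \<le> real n + sqrt (real n * (\<delta>0 / \<mu>)) * sqrt (2 ^ t)" for t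
    proof -
      have "0 \<le> sqrt (\<delta>0 * 2 ^ t / (real n * \<mu>))"
        using assms by (simp add: \<delta>0_def)
      then have "real n * momentum_scale (\<delta>0 * 2 ^ t) n \<mu> \<le> real n * (1 + sqrt (\<delta>0 * 2 ^ t / (real n * \<mu>)))"
        by (intro mult_left_mono) (auto simp: momentum_scale_def)
      also have "\<dots> = real n + real n * sqrt (\<delta>0 * 2 ^ t / (real n * \<mu>))"
        by (simp add: distrib_left)
      also have "real n * sqrt (\<delta>0 * 2 ^ t / (real n * \<mu>)) = sqrt (real n ^ 2 * (\<delta>0 * 2 ^ t / (real n * \<mu>)))"
        by (simp only: real_sqrt_mult) simp
      also have "real n ^ 2 * (\<delta>0 * 2 ^ t / (real n * \<mu>)) = real n * (\<delta>0 / \<mu>) * 2 ^ t"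
        using \<open>0 < real n\<close> by (simp add: power2_eq_square)
      also have "sqrt (real n * (\<delta>0 / \<mu>) * 2 ^ t) = sqrt (real n * (\<delta>0 / \<mu>)) * sqrt (2 ^ t)"
        by (rule real_sqrt_mult)
      finally show ?thesis .
    qed
    then have "(\<Sum>t<T. real n * momentum_scale (\<delta>0 * 2 ^ t) n \<mu>)
        \<le> (\<Sum>t<T. real n + sqrt (real n * (\<delta>0 / \<mu>)) * sqrt (2 ^ t))"
      by (rule sum_mono)
    also have "\<dots> = real n * real T + sqrt (real n * (\<delta>0 / \<mu>)) * (\<Sum>t<T. sqrt (2 ^ t))"
      by (simp add: sum.distrib sum_distrib_left)
    also have "\<dots> \<le> real n * real T + sqrt (real n * (\<delta>0 / \<mu>)) * (3 * sqrt (2 * (4 * \<Delta> / \<epsilon>)))"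
    proof (intro add_left_mono mult_left_mono order_trans[OF sum_sqrt_two_powers_le])
      show "sqrt (2 ^ T) \<le> sqrt (2 * (4 * \<Delta> / \<epsilon>))" using T(2) by simp
      show "0 \<le> sqrt (real n * (\<delta>0 / \<mu>))" using assms by (simp add: \<delta>0_def)
    qed simp
    also have "sqrt (real n * (\<delta>0 / \<mu>)) * (3 * sqrt (2 * (4 * \<Delta> / \<epsilon>)))
        = 3 * sqrt (real n * (\<delta>0 / \<mu>) * (2 * (4 * \<Delta> / \<epsilon>)))"
      by (simp only: real_sqrt_mult mult_ac)
    \<comment> \<open>\<open>\<Delta>\<close> cancels: the last smoothing parameter is of order
      \<open>G\<^sup>2 / \<epsilon>\<close>.\<close>
    also have "real n * (\<delta>0 / \<mu>) * (2 * (4 * \<Delta> / \<epsilon>)) = 2\<^sup>2 * (real n * G\<^sup>2 / (\<mu> * \<epsilon>))"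
      using False \<open>0 < \<Delta>\<close> assms(1,5) by (simp add: \<delta>0_def field_simps)
    also have "3 * sqrt \<dots> = 6 * R"
      using \<open>0 < G\<close> by (simp add: R_def real_sqrt_mult real_sqrt_divide)
    finally show ?thesis .
  qed
  also have "real n * real T \<le> real n * (8 * ln (\<Delta> / \<epsilon>))"
    by (intro mult_left_mono T_le) simp
  finally have sum: "(\<Sum>t<T. real n * momentum_scale (\<delta>0 * 2 ^ t) n \<mu>) \<le> 8 * (real n * ln (\<Delta> / \<epsilon>)) + 6 * R"
    by simp
  have "0 \<le> real n * ln (\<Delta> / \<epsilon>)" using \<open>2 \<le> \<Delta> / \<epsilon>\<close> by simp
  moreover have "(\<Sum>t<T. 48 * real n * momentum_scale (\<delta>0 * 2 ^ t) n \<mu>)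
      = 48 * (\<Sum>t<T. real n * momentum_scale (\<delta>0 * 2 ^ t) n \<mu>)"
    by (simp add: sum_distrib_left mult.assoc)
  \<comment> \<open>The coefficients are \<open>48 * 8\<close> and \<open>48 * 6\<close>, both below
    1000.\<close>
  ultimately show ?thesis using sum \<open>0 \<le> R\<close> unfolding R_def[symmetric] distrib_left by linarith
qed

text \<open>The quantifier order makes \<open>T\<close> depend on \<open>\<Delta>\<close>,
  \<open>G\<close> and \<open>\<epsilon>\<close> at most, and the ASVRG parameters are fixed before
  the functions are given. The count is bounded for every outcome, with 1000 as the absolute
  constant.\<close>

theorem corollary14:
  fixes \<Delta> G \<epsilon> :: real
  assumes "0 < \<epsilon>" and "\<epsilon> \<le> \<Delta> / 2"
  shows "\<exists>(\<delta>0 :: nat \<Rightarrow> real \<Rightarrow> real) (T :: nat).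
    (G \<noteq> 0 \<longrightarrow> (\<exists>c. \<forall>n \<mu>. \<delta>0 n \<mu> = c)) \<and>
    (\<forall>(n :: nat) (\<mu> :: real). 1 \<le> n \<longrightarrow> 0 < \<mu> \<longrightarrow>
      0 < \<delta>0 n \<mu> \<and>
      (\<exists>(\<eta> :: nat \<Rightarrow> real) (\<omega> :: nat \<Rightarrow> real) (m :: nat \<Rightarrow> nat).
        (\<forall>t<T. asvrg_parameters (\<delta>0 n \<mu> * 2 ^ t) (\<eta> t) (\<omega> t) (m t)) \<and>
        (\<forall>(f :: nat \<Rightarrow> 'a::euclidean_space \<Rightarrow> real) (g :: 'a \<Rightarrow> real) (x0 :: 'a) (xs :: 'a).
          (\<forall>i<n. convex_on UNIV (f i) \<and> G-lipschitz_on UNIV (f i)) \<longrightarrow>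
          strongly_convex \<mu> g \<longrightarrow>
          is_arg_min (objective n f g) (\<lambda>x. True) xs \<longrightarrow>
          objective n f g x0 - objective n f g xs = \<Delta> \<longrightarrow>
          (\<exists>p. adaptive_smoothing n f g \<mu> (\<delta>0 n \<mu>) \<eta> \<omega> m x0 T p \<and>
            expected_value (objective n f g) p - objective n f g xs \<le> \<epsilon> \<and>
            (\<forall>(x, c) \<in> set_pmf p. real c \<le>
              1000 * (real n * ln ((objective n f g x0 - objective n f g xs) / \<epsilon>)
                      + sqrt (real n) * G / sqrt (\<mu> * \<epsilon>)))))))"
proof -
  define T where "T = nat \<lceil>log 2 (4 * \<Delta> / \<epsilon>)\<rceil>"
  \<comment> \<open>For \<open>G = 0\<close> smoothing is exact, and this choice keeps every \<open>momentum_scale\<close> equal to \<open>1\<close>; otherwise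
    the initial smoothing error \<open>G\<^sup>2 / (2 * \<delta>0)\<close> equals \<open>\<Delta>\<close>.\<close>
  define \<delta>0 where "\<delta>0 = (\<lambda>(n::nat) (\<mu>::real). if G = 0 then real n * \<mu> / 2 ^ T else G\<^sup>2 / (2 * \<Delta>))"
  have "0 < \<Delta>" using assms by linarith
  have "1 \<le> 4 * \<Delta> / \<epsilon>" using assms by (simp add: field_simps)
  then have "4 * \<Delta> / \<epsilon> \<le> 2 ^ T" unfolding T_def by (rule two_power_ceiling_log)
  then have accuracy: "4 * \<Delta> / 2 ^ T \<le> \<epsilon>" using \<open>0 < \<epsilon>\<close> by (simp add: field_simps)
  show ?thesis
  proof (intro exI[of _ \<delta>0] exI[of _ T] conjI allI impI)
    show "\<exists>c. \<forall>n \<mu>. \<delta>0 n \<mu> = c" if "G \<noteq> 0"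
      using that by (simp add: \<delta>0_def)
    fix n :: nat and \<mu> :: real
    assume n: "1 \<le> n" and \<mu>: "0 < \<mu>"
    show pos: "0 < \<delta>0 n \<mu>" using n \<mu> \<open>0 < \<Delta>\<close> by (simp add: \<delta>0_def)
    define L where "L t = \<delta>0 n \<mu> * 2 ^ t" for t
    have L: "0 < L t" for t using pos by (simp add: L_def)
    define q where "q t = momentum_scale (L t) n \<mu>" for t
    have q: "1 \<le> q t" "L t / (real n * \<mu>) \<le> (q t)\<^sup>2" for t
      unfolding q_def using momentum_scale_ge[OF L n \<mu>] by auto
    define \<eta> \<omega> where "\<eta> t = 1 / (4 * L t)" and "\<omega> t = 1 / (2 * q t)" for t
    have parameters: "asvrg_parameters (\<delta>0 n \<mu> * 2 ^ t) (\<eta> t) (\<omega> t) n" for t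
      unfolding \<eta>_def \<omega>_def L_def[symmetric] by (rule asvrg_parameters_choice[OF n L q(1)])
    show "\<exists>(\<eta> :: nat \<Rightarrow> real) (\<omega> :: nat \<Rightarrow> real) (m :: nat \<Rightarrow> nat).
        (\<forall>t<T. asvrg_parameters (\<delta>0 n \<mu> * 2 ^ t) (\<eta> t) (\<omega> t) (m t)) \<and>
        (\<forall>(f :: nat \<Rightarrow> 'a::euclidean_space \<Rightarrow> real) (g :: 'a \<Rightarrow> real) (x0 :: 'a) (xs :: 'a).
          (\<forall>i<n. convex_on UNIV (f i) \<and> G-lipschitz_on UNIV (f i)) \<longrightarrow>
          strongly_convex \<mu> g \<longrightarrow>
          is_arg_min (objective n f g) (\<lambda>x. True) xs \<longrightarrow>
          objective n f g x0 - objective n f g xs = \<Delta> \<longrightarrow>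
          (\<exists>p. adaptive_smoothing n f g \<mu> (\<delta>0 n \<mu>) \<eta> \<omega> m x0 T p \<and>
            expected_value (objective n f g) p - objective n f g xs \<le> \<epsilon> \<and>
            (\<forall>(x, c) \<in> set_pmf p. real c \<le>
              1000 * (real n * ln ((objective n f g x0 - objective n f g xs) / \<epsilon>)
                      + sqrt (real n) * G / sqrt (\<mu> * \<epsilon>)))))"
    \<comment> \<open>Epoch length \<open>n\<close> keeps the inner loop at \<open>2 * n\<close>
      evaluations, comparable to the \<open>n\<close> of the full gradient.\<close>
    proof (rule exI[of _ \<eta>], rule exI[of _ \<omega>], rule exI[of _ "\<lambda>_. n"], intro conjI allI impI)
      show "asvrg_parameters (\<delta>0 n \<mu> * 2 ^ t) (\<eta> t) (\<omega> t) n" for t by (rule parameters)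
      fix f :: "nat \<Rightarrow> 'a \<Rightarrow> real" and g :: "'a \<Rightarrow> real" and x0 xs :: 'a
      assume f: "\<forall>i<n. convex_on UNIV (f i) \<and> G-lipschitz_on UNIV (f i)"
        and g: "strongly_convex \<mu> g"
        and min: "is_arg_min (objective n f g) (\<lambda>x. True) xs"
        and \<Delta>: "objective n f g x0 - objective n f g xs = \<Delta>"
      have "0 \<le> G" using f n lipschitz_on_nonneg by (metis less_eq_Suc_le One_nat_def)
      have gap: "objective n f g x0 - objective n f g y \<le> \<Delta>" for y
      proof -
        have "objective n f g xs \<le> objective n f g y"
          using min by (simp add: is_arg_min_linorder)
        then show ?thesis using \<Delta> by linarith
      qed
      have \<delta>0_ge: "G\<^sup>2 / (2 * \<delta>0 n \<mu>) \<le> \<Delta>"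
        using \<open>0 < \<Delta>\<close> by (simp add: \<delta>0_def)
      obtain p where p: "adaptive_smoothing n f g \<mu> (\<delta>0 n \<mu>) \<eta> \<omega> (\<lambda>_. n) x0 T p"
        and accurate: "\<And>y. expected_value (objective n f g) p
            - objective n (\<lambda>i. moreau_envelope (\<delta>0 n \<mu> * 2 ^ T) (f i)) g y \<le> 4 * \<Delta> / 2 ^ T"
        and cost: "\<And>x c. (x, c) \<in> set_pmf p \<Longrightarrow>
            c \<le> (\<Sum>t<T. 2 * (restart_length (\<eta> t) (\<omega> t) n \<mu> * (n + 2 * n)))"
        using adaptive_smoothing_rounds[OF n \<mu> pos f[rule_format] g parameters gap \<delta>0_ge order_refl] by blast
      have "expected_value (objective n f g) p - objective n f g xs \<le> \<epsilon>"
      proof -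
        have "objective n (\<lambda>i. moreau_envelope (\<delta>0 n \<mu> * 2 ^ T) (f i)) g xs \<le> objective n f g xs"
          by (intro objective_mono moreau_envelope_le) (use f pos in auto)
        then show ?thesis using accurate[of xs] accuracy by linarith
      qed
      moreover have "real c \<le> 1000 * (real n * ln (\<Delta> / \<epsilon>) + sqrt (real n) * G / sqrt (\<mu> * \<epsilon>))"
        if "(x, c) \<in> set_pmf p" for x c
      proof -
        have "real c \<le> real (\<Sum>t<T. 2 * (restart_length (\<eta> t) (\<omega> t) n \<mu> * (n + 2 * n)))"
          using cost[OF that] by (simp only: of_nat_le_iff)
        also have "\<dots> = (\<Sum>t<T. 6 * real n * real (restart_length (\<eta> t) (\<omega> t) n \<mu>))"
          by (simp add: algebra_simps)
        \<comment> \<open>The 6 stems from two periods with \<open>3 * n\<close> evaluations per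
          epoch, the 8 from the number of epochs in a period.\<close>
        also have "\<dots> \<le> (\<Sum>t<T. 6 * real n * (8 * q t))"
          unfolding \<eta>_def \<omega>_def
          by (intro sum_mono mult_left_mono restart_length_le n \<mu> L q) auto
        also have "\<dots> = (\<Sum>t<T. 48 * real n * momentum_scale (\<delta>0 n \<mu> * 2 ^ t) n \<mu>)"
          by (simp add: q_def L_def mult.assoc)
        also have "\<dots> \<le> 1000 * (real n * ln (\<Delta> / \<epsilon>) + sqrt (real n) * G / sqrt (\<mu> * \<epsilon>))"
          unfolding \<delta>0_def T_def
          by (rule total_evaluations_le) (use assms \<open>0 \<le> G\<close> n \<mu> in auto)
        finally show ?thesis .
      qed
      ultimately show "\<exists>p. adaptive_smoothing n f g \<mu> (\<delta>0 n \<mu>) \<eta> \<omega> (\<lambda>_. n) x0 T p \<and>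
            expected_value (objective n f g) p - objective n f g xs \<le> \<epsilon> \<and>
            (\<forall>(x, c) \<in> set_pmf p. real c \<le>
              1000 * (real n * ln ((objective n f g x0 - objective n f g xs) / \<epsilon>)
                      + sqrt (real n) * G / sqrt (\<mu> * \<epsilon>)))"
        using p unfolding \<Delta> by blast
    qed
  qed
qed

end
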